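(* Let $C\in(0,1)$. For $i=0,1$ let $\lambda_{i}$ be real numbers with $\min\{\lambda_{0},\lambda_{1}\}>\frac{5+\sqrt{17}}{2}$, and let $\Phi_{i}:\mathbb{N}\to(0,\infty)$ be decreasing functions with $\Phi_{i}(q)\leq q^{-\lambda_{i}}$ for all $q\geq q_{0}$ (some $q_0$). Then \[ \mathscr{W}_{\Phi_{0},C}+\mathscr{W}_{\Phi_{1},C}\supseteq\mathscr{W}_{2}. \] In particular, the sumset $\mathscr{W}_{\Phi_{0},C}+\mathscr{W}_{\Phi_{1},C}$ has Hausdorff dimension $1$, and each $\mathscr{W}_{\Phi_{i},C}$ ($i=0,1$) has packing dimension $1$.
   Context: For a decreasing $\Phi:\mathbb{N}\to(0,\infty)$ and $C\in(0,1)$, $\mathscr{W}_{\Phi,C}$ is the set of real $\xi$ such that $|\xi-p/q|\leq\Phi(q)$ has infinitely many rational solutions $p/q$, while $|\xi-p/q|>C\,\Phi(q)$ holds for all but finitely many rationals $p/q$. For $\xi\in\mathbb{R}$, the irrationality exponent $\mu(\xi)$ is the supremum of all $\mu$ such that $|\xi-p/q|\leq q^{-\mu}$ has infinitely many rational solutions $p/q$ ($q\geq 1$), and $\mathscr{W}_{2}=\{\xi\in\mathbb{R}:\mu(\xi)=2\}$. *)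

theory Defs
  imports "HOL-Analysis.Analysis"
begin

section \<open>Rational approximation\<close>

text \<open>
  The rational numbers \<open>p/q\<close> (\<open>q \<ge> 1\<close>) with \<open>\<bar>\<xi> - p/q\<bar> \<le> \<psi> q\<close>. This is a set of numbers, not of
  pairs \<open>(p, q)\<close>: a rational counts once, however many of its fractions satisfy the inequality.
\<close>
definition approximants :: "(nat \<Rightarrow> real) \<Rightarrow> real \<Rightarrow> real set" where
  "approximants \<psi> \<xi> =
     {of_int p / of_nat q | (p::int) (q::nat). q \<ge> 1 \<and> \<bar>\<xi> - of_int p / of_nat q\<bar> \<le> \<psi> q}"

text \<open>
  The second condition says that \<open>\<bar>\<xi> - p/q\<bar> > C * \<Phi> q\<close> fails for only finitely many rationals.
\<close>
definition exact_approx_set :: "(nat \<Rightarrow> real) \<Rightarrow> real \<Rightarrow> real set" where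
  "exact_approx_set \<Phi> C =
     {\<xi>. infinite (approximants \<Phi> \<xi>) \<and> finite (approximants (\<lambda>q. C * \<Phi> q) \<xi>)}"

definition irrationality_exponent :: "real \<Rightarrow> ereal" where
  "irrationality_exponent \<xi> =
     Sup {ereal \<mu> | \<mu>::real. infinite (approximants (\<lambda>q. of_nat q powr (- \<mu>)) \<xi>)}"

definition W2 :: "real set" where
  "W2 = {\<xi>. irrationality_exponent \<xi> = 2}"


section \<open>Hausdorff dimension\<close>

text \<open>
  The covering sets are required to be bounded because \<^const>\<open>diameter\<close> is only meaningful then.
\<close>
definition hausdorff_premeasure :: "real \<Rightarrow> real \<Rightarrow> 'a::metric_space set \<Rightarrow> ennreal" where
  "hausdorff_premeasure s \<delta> A =
     Inf {(\<Sum>i. ennreal (diameter (U i) powr s)) | U :: nat \<Rightarrow> 'a set.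
            A \<subseteq> (\<Union>i. U i) \<and> (\<forall>i. bounded (U i) \<and> diameter (U i) \<le> \<delta>)}"

definition hausdorff_measure :: "real \<Rightarrow> 'a::metric_space set \<Rightarrow> ennreal" where
  "hausdorff_measure s A = (SUP \<delta>\<in>{0<..}. hausdorff_premeasure s \<delta> A)"

text \<open>
  Here and for the packing dimension only exponents \<open>s > 0\<close> are considered, since \<open>0 powr 0 = 0\<close>;
  leaving out \<open>s = 0\<close> does not change the infimum.
\<close>
definition hausdorff_dim :: "'a::metric_space set \<Rightarrow> ereal" where
  "hausdorff_dim A = Inf {ereal s | s. 0 < s \<and> hausdorff_measure s A = 0}"


section \<open>Packing dimension\<close>

text \<open>
  A \<open>\<delta>\<close>-packing of \<open>A\<close> is a countable family of pairwise disjoint closed balls with centres in \<open>A\<close>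
  and radii at most \<open>\<delta>\<close>, given here by its set of (centre, radius) pairs. In a Euclidean space
  \<open>2 * r\<close> is the diameter of a ball of radius \<open>r\<close>.
\<close>
definition packings :: "real \<Rightarrow> 'a::euclidean_space set \<Rightarrow> ('a \<times> real) set set" where
  "packings \<delta> A =
     {K. countable K \<and> K \<subseteq> A \<times> {0<..\<delta>} \<and> disjoint_family_on (\<lambda>(x, r). cball x r) K}"

definition packing_premeasure_delta :: "real \<Rightarrow> real \<Rightarrow> 'a::euclidean_space set \<Rightarrow> ennreal" where
  "packing_premeasure_delta s \<delta> A =
     (SUP K\<in>packings \<delta> A. \<Sum>\<^sub>\<infinity>(x, r)\<in>K. ennreal ((2 * r) powr s))"

definition packing_premeasure :: "real \<Rightarrow> 'a::euclidean_space set \<Rightarrow> ennreal" where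
  "packing_premeasure s A = (INF \<delta>\<in>{0<..}. packing_premeasure_delta s \<delta> A)"

text \<open>
  The premeasure is not countably subadditive, hence the additional infimum over countable covers.
\<close>
definition packing_measure :: "real \<Rightarrow> 'a::euclidean_space set \<Rightarrow> ennreal" where
  "packing_measure s A =
     Inf {(\<Sum>i. packing_premeasure s (B i)) | B :: nat \<Rightarrow> 'a set. A \<subseteq> (\<Union>i. B i)}"

definition packing_dim :: "'a::euclidean_space set \<Rightarrow> ereal" where
  "packing_dim A = Inf {ereal s | s. 0 < s \<and> packing_measure s A = 0}"

end

theory Submission
  imports Defs
begin

text \<open>
  Let \<open>\<xi>\<close> have irrationality exponent \<open>2\<close> and \<open>L = min L\<^sub>0 L\<^sub>1\<close>. One chooses reduced fractions \<open>p\<^sub>n/q\<^sub>n\<close> such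
  that alternately \<open>x\<close> (even \<open>n\<close>) and \<open>\<xi> - x\<close> (odd \<open>n\<close>) lies to the right of
  \<open>p\<^sub>n/q\<^sub>n\<close> at a distance between \<open>C * \<Phi> q\<^sub>n\<close> and \<open>\<Phi> q\<^sub>n\<close>, where \<open>q\<^sub>n\<^sub>+\<^sub>1\<close> is at most a constant times \<open>1 / \<Phi> q\<^sub>n\<close>. No other \<open>p/q\<close> with \<open>q\<close> large is within
  \<open>\<Phi> q\<close> of \<open>x\<close>: either \<open>q\<close> is so small that \<open>p/q\<close> is kept away by the close approximation \<open>p\<^sub>n/q\<^sub>n\<close>, or
  \<open>p/q + p\<^sub>n\<^sub>+\<^sub>1/q\<^sub>n\<^sub>+\<^sub>1\<close> would be a rational too close to \<open>\<xi>\<close>. The two ranges of \<open>q\<close> overlap exactly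
  when \<open>L\<^sup>2 - 5 * L + 2 > 0\<close>.

  The Hausdorff dimension follows because almost every real has irrationality exponent \<open>2\<close>. For the packing
  dimension of one summand, let the other function be \<open>q powr - K\<close> with \<open>K\<close> huge: if the packing dimension
  were less than \<open>1\<close>, the sumset would be a null set.
\<close>

section \<open>Exponents and fractions\<close>

lemma powr_eventually_less:
  fixes a b K M :: real
  assumes "a < b" "M > 0"
  shows "eventually (\<lambda>T. K * T powr a < M * T powr b) at_top"
proof -
  have "((\<lambda>T. K * T powr (a - b)) \<longlongrightarrow> K * 0) at_top"
    using assms by (intro tendsto_intros tendsto_neg_powr filterlim_ident) auto
  then have "eventually (\<lambda>T. K * T powr (a - b) < M) at_top"
    using assms by (intro order_tendstoD(2)) auto
  moreover have "eventually (\<lambda>T::real. T > 0) at_top"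
    by (rule eventually_gt_at_top)
  ultimately show ?thesis
  proof eventually_elim
    case (elim T)
    have "K * T powr (a - b) * T powr b < M * T powr b"
      using elim by (intro mult_strict_right_mono) auto
    then show ?case by (simp add: mult.assoc powr_add[symmetric])
  qed
qed

text \<open>For large \<open>T\<close> only the exponents of \<open>T\<close> count. The first two
  inequalities reduce to the bound on \<open>\<eta>\<close>, the third to
  \<open>2 * \<eta> < L\<close>, which that bound implies. The first two feed
  \<open>no_other_approximation\<close>, the third \<open>next_fraction\<close>.\<close>

lemma exponent_thresholds:
  fixes L \<eta> c :: real
  assumes c: "c > 0" and L: "L > 1" and eta: "\<eta> > 0" "\<eta> < L * (L - 1) / (2 * L - 1)"
  shows "\<exists>T\<^sub>0\<ge>1. \<forall>T\<ge>T\<^sub>0. 2 * (c * T) powr \<eta> < (T powr (1 - 1 / L) / 2) powr (L - \<eta>)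
     \<and> 2 * ((2 * c * T) powr (1 / (L - 1)) * T powr (1 / L)) powr \<eta> \<le> T
     \<and> c * T \<le> T powr (L / \<eta> - 1)"
proof -
  have eta': "\<eta> * (2 * L - 1) < L * (L - 1)"
    using eta L by (simp add: field_simps)
  have "eventually (\<lambda>T. (2 * c powr \<eta>) * T powr \<eta> < ((1/2) powr (L - \<eta>)) * T powr ((1 - 1 / L) * (L - \<eta>))) at_top"
  proof (rule powr_eventually_less)
    show "\<eta> < (1 - 1 / L) * (L - \<eta>)" using eta' L by (simp add: field_simps)
  qed auto
  moreover have "eventually (\<lambda>T. (2 * (2 * c) powr (\<eta> / (L - 1))) * T powr ((1 / (L - 1) + 1 / L) * \<eta>) < 1 * T powr 1) at_top"
  proof (rule powr_eventually_less)
    have "(1 / (L - 1) + 1 / L) = (2 * L - 1) / (L * (L - 1))"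
      using L by (simp add: field_simps)
    then show "(1 / (L - 1) + 1 / L) * \<eta> < 1" using eta' L by (simp add: field_simps)
  qed auto
  moreover have "eventually (\<lambda>T. c * T powr 1 < 1 * T powr (L / \<eta> - 1)) at_top"
  proof (rule powr_eventually_less)
    have "2 * \<eta> * (2 * L - 1) < L * (2 * L - 1)" using eta' L by (simp add: algebra_simps)
    then have "2 * \<eta> < L" using L by simp
    then show "1 < L / \<eta> - 1" using eta by (simp add: field_simps)
  qed auto
  moreover have "eventually (\<lambda>T::real. T \<ge> 1) at_top"
    by (rule eventually_ge_at_top)
  ultimately have "eventually (\<lambda>T. T \<ge> 1 \<and> 2 * (c * T) powr \<eta> < (T powr (1 - 1 / L) / 2) powr (L - \<eta>)
     \<and> 2 * ((2 * c * T) powr (1 / (L - 1)) * T powr (1 / L)) powr \<eta> \<le> T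
     \<and> c * T \<le> T powr (L / \<eta> - 1)) at_top"
  proof eventually_elim
    case (elim T)
    have "(c * T) powr \<eta> = c powr \<eta> * T powr \<eta>"
      using elim c by (simp add: powr_mult)
    moreover have "(T powr (1 - 1 / L) / 2) powr (L - \<eta>) = (1/2) powr (L - \<eta>) * T powr ((1 - 1 / L) * (L - \<eta>))"
      using powr_mult[of "T powr (1 - 1/L)" "1/2" "L - \<eta>"] by (simp add: powr_powr mult.commute)
    moreover have "((2 * c * T) powr (1 / (L - 1)) * T powr (1 / L)) powr \<eta>
        = (2 * c) powr (\<eta> / (L - 1)) * T powr ((1 / (L - 1) + 1 / L) * \<eta>)"
      using elim c powr_mult[of "2 * c" T "1 / (L - 1)"]
      by (simp add: powr_mult powr_powr powr_add distrib_right)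
    ultimately show ?case using elim by simp
  qed
  then obtain T0 where "\<forall>T\<ge>T0. T \<ge> 1 \<and> 2 * (c * T) powr \<eta> < (T powr (1 - 1 / L) / 2) powr (L - \<eta>)
     \<and> 2 * ((2 * c * T) powr (1 / (L - 1)) * T powr (1 / L)) powr \<eta> \<le> T
     \<and> c * T \<le> T powr (L / \<eta> - 1)"
    by (auto simp: eventually_at_top_linorder)
  then show ?thesis by (intro exI[of _ "max T0 1"]) auto
qed

section \<open>Fractions in short intervals and the distance between fractions\<close>

lemma fraction_in_interval:
  fixes u l :: real
  assumes "0 < l" "l \<le> 1"
  obtains p :: int and q :: nat where "q \<ge> 1" "coprime p (int q)" "u \<le> of_int p / of_nat q"
    "of_int p / of_nat q \<le> u + l" "of_nat q \<le> 2 / l"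
proof -
  \<comment> \<open>The multiples of \<open>1 / m\<close> have spacing at most \<open>l\<close>, so
    rounding \<open>u * m\<close> up lands in the interval; \<open>l \<le> 1\<close> keeps
    \<open>m\<close> below \<open>2 / l\<close>.\<close>
  define m where "m = nat \<lceil>1 / l\<rceil>"
  define k where "k = \<lceil>u * m\<rceil>"
  have m: "of_nat m \<ge> 1 / l" "of_nat m \<le> 1 / l + 1"
    using assms unfolding m_def by (auto simp: le_of_int_ceiling of_nat_nat)
  have m2: "of_nat m \<le> 2 / l" using m assms by (simp add: field_simps)
  have m1: "m > 0" using m(1) assms by (cases m) (auto simp: field_simps)
  have k: "u * m \<le> k" "k \<le> u * m + 1" unfolding k_def by linarith+
  \<comment> \<open>Reducing to lowest terms only lowers the denominator, so its bound
    survives.\<close>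
  define g where "g = gcd k (int m)"
  have g: "g > 0" "g dvd k" "g dvd int m" using m1 by (auto simp: g_def)
  define q where "q = nat (int m div g)"
  have iq: "int q = int m div g" using g by (simp add: q_def pos_imp_zdiv_nonneg_iff)
  have qg: "int q * g = int m" using iq g by simp
  have rq: "real q * of_int g = real m" using qg by (metis of_int_mult of_int_of_nat_eq)
  have rk: "of_int (k div g) * of_int g = (of_int k :: real)" using g by (metis dvd_div_mult_self of_int_mult)
  have q1: "q \<ge> 1" using qg m1 by (cases q) auto
  have eq: "of_int (k div g) / of_nat q = (of_int k / of_nat m :: real)"
    unfolding rq[symmetric] rk[symmetric] using g q1 by simp
  have "coprime (k div g) (int q)"
    unfolding iq g_def using m1 by (intro div_gcd_coprime) auto
  moreover have "u \<le> of_int k / of_nat m" using k m1 by (simp add: field_simps)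
  moreover have "of_int k / of_nat m \<le> u + l"
  proof -
    have "1 \<le> l * m" using m assms by (simp add: field_simps)
    then have "of_int k \<le> (u + l) * m" using k by (simp add: algebra_simps)
    then show ?thesis using m1 by (simp add: field_simps)
  qed
  moreover have "real q \<le> real m" using rq g q1
    by (metis mult_left_mono mult.right_neutral of_int_1_le_iff of_nat_0_le_iff int_one_le_iff_zero_less)
  ultimately show thesis using that[of q "k div g"] q1 eq m2 by auto
qed

lemma distinct_fractions_dist:
  fixes p p' :: int and q q' :: nat
  assumes "q \<ge> 1" "q' \<ge> 1" "of_int p / of_nat q \<noteq> (of_int p' / of_nat q' :: real)"
  shows "\<bar>of_int p / of_nat q - of_int p' / of_nat q'\<bar> \<ge> 1 / (real q * real q')"
proof -
  have eq: "of_int p / of_nat q - of_int p' / of_nat q' = (of_int (p * int q' - p' * int q) / (real q * real q') :: real)"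
    using assms by (simp add: field_simps)
  have "p * int q' - p' * int q \<noteq> 0" using assms(3) eq by fastforce
  then have "(1::int) \<le> \<bar>p * int q' - p' * int q\<bar>" by linarith
  then have "1 \<le> \<bar>of_int (p * int q' - p' * int q) :: real\<bar>"
    by (metis of_int_1_le_iff of_int_abs)
  then show ?thesis unfolding eq abs_divide using assms
    by (simp add: divide_right_mono abs_mult)
qed

lemma fraction_numerator_bounds:
  fixes p :: int and q :: nat and \<xi> r :: real
  assumes "q \<ge> 1" "\<bar>\<xi> - of_int p / of_nat q\<bar> \<le> r"
  shows "p \<in> {\<lfloor>(\<xi> - r) * real q\<rfloor>..\<lceil>(\<xi> + r) * real q\<rceil>}"
proof -
  have "(\<xi> - r) * q \<le> p" "p \<le> (\<xi> + r) * q"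
    using assms by (simp_all add: abs_le_iff field_simps)
  then show ?thesis by simp linarith
qed

section \<open>Finiteness of sets of approximants\<close>

lemma finite_approximants_bounded:
  fixes \<xi> :: real and \<psi> :: "nat \<Rightarrow> real"
  shows "finite {of_int p / real q | (p::int) (q::nat). q \<ge> 1 \<and> q < N \<and> \<bar>\<xi> - of_int p / of_nat q\<bar> \<le> \<psi> q}"
proof -
  have "{of_int p / real q | (p::int) (q::nat). q \<ge> 1 \<and> q < N \<and> \<bar>\<xi> - of_int p / of_nat q\<bar> \<le> \<psi> q}
     \<subseteq> (\<lambda>(q, p). of_int p / of_nat q :: real) `
         Sigma {..<N} (\<lambda>q. {\<lfloor>(\<xi> - \<psi> q) * real q\<rfloor>..\<lceil>(\<xi> + \<psi> q) * real q\<rceil>})"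
    using fraction_numerator_bounds by force
  then show ?thesis by (rule finite_subset) auto
qed

text \<open>Denominators below \<open>N\<close> contribute finitely many values, so only large ones
  matter. The set \<open>S\<close> leaves room for a rational \<open>\<xi>\<close>, which
  approximates itself with every multiple of its denominator.\<close>

lemma finite_approximantsI:
  assumes "\<And>p q. q \<ge> N \<Longrightarrow> q \<ge> 1 \<Longrightarrow> \<bar>\<xi> - of_int p / of_nat q\<bar> \<le> \<psi> q \<Longrightarrow> of_int p / real q \<in> S" "finite S"
  shows "finite (approximants \<psi> \<xi>)"
proof -
  have "approximants \<psi> \<xi> \<subseteq> S \<union> {of_int p / real q | (p::int) (q::nat). q \<ge> 1 \<and> q < N \<and> \<bar>\<xi> - of_int p / of_nat q\<bar> \<le> \<psi> q}"
    unfolding approximants_def using assms(1) not_le by blast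
  then show ?thesis using assms(2) finite_approximants_bounded finite_subset by blast
qed

text \<open>The exponent only limits the rational values, whereas the conclusion concerns all pairs
  \<open>P\<close>, \<open>Q\<close>, reduced or not. As \<open>\<xi>\<close> is irrational, the
  finitely many exceptional values keep a positive distance from it, which excludes all their
  representations with large \<open>Q\<close>.\<close>

lemma W2_dist_gt:
  assumes "\<xi> \<in> W2" "\<eta> > 2"
  obtains Q\<^sub>0 where "\<And>P Q. Q \<ge> Q\<^sub>0 \<Longrightarrow> \<bar>\<xi> - of_int P / of_nat Q\<bar> > real Q powr (- \<eta>)"
proof -
  have exp2: "irrationality_exponent \<xi> = 2" using assms by (simp add: W2_def)
  have "\<not> infinite (approximants (\<lambda>q. of_nat q powr (- \<eta>)) \<xi>)"
  proof
    assume "infinite (approximants (\<lambda>q. of_nat q powr (- \<eta>)) \<xi>)"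
    then have "ereal \<eta> \<le> irrationality_exponent \<xi>"
      unfolding irrationality_exponent_def by (intro Sup_upper) auto
    then show False using exp2 assms by simp
  qed
  then have fin: "finite (approximants (\<lambda>q. of_nat q powr (- \<eta>)) \<xi>)" (is "finite ?A") by simp
  \<comment> \<open>A rational \<open>a / b\<close> would have exponent at most
    \<open>3 / 2\<close>: any other fraction is at distance at least \<open>1 / (b * q)\<close>,
    which exceeds \<open>q powr (- 3 / 2)\<close> once \<open>q > b\<^sup>2\<close>.\<close>
  have irr: "\<xi> \<noteq> of_int a / of_nat b" if "b \<ge> 1" for a b
  proof
    assume xi: "\<xi> = of_int a / of_nat b"
    have "\<mu> \<le> 3 / 2" if "infinite (approximants (\<lambda>q. of_nat q powr (- \<mu>)) \<xi>)" for \<mu>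
    proof (rule ccontr)
      assume mu: "\<not> \<mu> \<le> 3 / 2"
      have "finite (approximants (\<lambda>q. of_nat q powr (- \<mu>)) \<xi>)"
      proof (rule finite_approximantsI[where N = "b\<^sup>2 + 1" and S = "{\<xi>}"])
        fix p q assume q: "q \<ge> b\<^sup>2 + 1" "q \<ge> (1::nat)" "\<bar>\<xi> - of_int p / of_nat q\<bar> \<le> of_nat q powr (- \<mu>)"
        show "of_int p / of_nat q \<in> {\<xi>}"
        proof (rule ccontr)
          assume "of_int p / of_nat q \<notin> {\<xi>}"
          then have "1 / (real b * real q) \<le> \<bar>\<xi> - of_int p / of_nat q\<bar>"
            using distinct_fractions_dist[of b q a p] \<open>b \<ge> 1\<close> q xi by auto
          also have "\<dots> \<le> real q powr (- 3 / 2)"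
            using q mu by (intro order_trans[OF q(3)] powr_mono) auto
          also have "\<dots> = 1 / (real q * sqrt (real q))"
            using q powr_add[of "real q" 1 "1/2"] by (simp add: powr_minus powr_half_sqrt field_simps)
          finally have "sqrt (real q) \<le> real b" using q \<open>b \<ge> 1\<close> by (simp add: field_simps)
          then have "real q \<le> (real b)\<^sup>2" using sqrt_le_D by blast
          then show False using q by (metis not_less_eq_eq of_nat_le_iff of_nat_power Suc_eq_plus1)
        qed
      qed auto
      then show False using that by simp
    qed
    then have "irrationality_exponent \<xi> \<le> ereal (3 / 2)"
      unfolding irrationality_exponent_def by (intro Sup_least) auto
    then show False using exp2 by simp
  qed
  \<comment> \<open>Inserting \<open>1\<close> keeps the minimum defined when there is no
    exceptional value.\<close>
  define d where "d = Min (insert 1 ((\<lambda>r. \<bar>\<xi> - r\<bar>) ` ?A))"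
  have "d > 0" unfolding d_def using fin irr by (subst Min_gr_iff) (auto simp: approximants_def)
  have d: "d \<le> \<bar>\<xi> - r\<bar>" if "r \<in> ?A" for r unfolding d_def using fin that by (intro Min_le) auto
  have "eventually (\<lambda>T::real. 1 * T powr (- \<eta>) < d * T powr 0) at_top"
    using assms \<open>d > 0\<close> by (intro powr_eventually_less) auto
  then obtain T where T: "\<And>t. t \<ge> T \<Longrightarrow> 1 * t powr (- \<eta>) < d * t powr 0"
    by (auto simp: eventually_at_top_linorder)
  show thesis
  proof (rule that[of "nat \<lceil>T\<rceil> + 1"])
    fix P Q assume Q: "nat \<lceil>T\<rceil> + 1 \<le> Q"
    have lt: "real Q powr (- \<eta>) < d" using T[of "real Q"] Q by simp linarith
    show "\<bar>\<xi> - of_int P / of_nat Q\<bar> > real Q powr (- \<eta>)"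
    proof (rule ccontr)
      assume n: "\<not> \<bar>\<xi> - of_int P / of_nat Q\<bar> > real Q powr (- \<eta>)"
      then have "of_int P / of_nat Q \<in> ?A" using Q unfolding approximants_def by force
      from d[OF this] n lt show False by simp
    qed
  qed
qed

section \<open>The alternating construction\<close>

text \<open>Consecutive steps give lower bounds on overlapping ranges of \<open>q\<close>:
  below \<open>T / (2 * q\<^sub>1)\<close> the rational \<open>p\<^sub>1/q\<^sub>1\<close> repels \<open>p/q\<close>; above it \<open>p/q + p\<^sub>2/q\<^sub>2\<close> is a rational of
  controlled denominator close to \<open>\<xi>\<close>. The hypothesis on \<open>q\<^sub>3\<close> says that the next approximation
  of \<open>x\<close> takes over.\<close>
lemma no_other_approximation:
  fixes L \<eta> c T T' \<xi> x :: real and p p\<^sub>1 p\<^sub>2 :: int and q q\<^sub>1 q\<^sub>2 q\<^sub>3 :: nat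
  assumes L: "L > 1" and eta: "0 < \<eta>" "\<eta> < L" and c: "c > 0" and T1: "T \<ge> 1" "T' \<ge> 1"
    and thr: "2 * (c * T) powr \<eta> < (T powr (1 - 1 / L) / 2) powr (L - \<eta>)"
      "2 * ((2 * c * T') powr (1 / (L - 1)) * T' powr (1 / L)) powr \<eta> \<le> T'"
    and q: "q \<ge> 1" "q\<^sub>1 \<ge> 1" "q\<^sub>2 \<ge> 1"
    and T: "real q\<^sub>1 powr L \<le> T" "real q\<^sub>2 powr L \<le> T'"
    and qs: "real q\<^sub>2 \<le> c * T" "real q\<^sub>3 \<le> c * T'"
    and range: "2 * real q\<^sub>1 < real q powr (L - 1)" "real q powr (L - 1) \<le> 2 * real q\<^sub>3"
    and xi: "\<bar>\<xi> - of_int (p * int q\<^sub>2 + p\<^sub>2 * int q) / of_nat (q * q\<^sub>2)\<bar> > real (q * q\<^sub>2) powr (- \<eta>)"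
    and x: "\<bar>x - of_int p\<^sub>1 / of_nat q\<^sub>1\<bar> \<le> 1 / T" "\<bar>\<xi> - x - of_int p\<^sub>2 / of_nat q\<^sub>2\<bar> \<le> 1 / T'"
    and ne: "of_int p / of_nat q \<noteq> (of_int p\<^sub>1 / of_nat q\<^sub>1 :: real)"
  shows "real q powr (- L) < \<bar>x - of_int p / of_nat q\<bar>"
proof (cases "2 * real q * real q\<^sub>1 \<le> T")
  \<comment> \<open>The two fractions are at least \<open>1 / (q * q\<^sub>1)\<close> apart, and
    \<open>x\<close> is within half of that of \<open>p\<^sub>1/q\<^sub>1\<close>. The remaining
    half exceeds \<open>q powr (- L)\<close> by the lower end of the range.\<close>
  case True
  have "1 / (real q * real q\<^sub>1) \<le> \<bar>of_int p / of_nat q - of_int p\<^sub>1 / of_nat q\<^sub>1\<bar>"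
    using distinct_fractions_dist[OF q(1,2) ne] .
  moreover have "1 / T \<le> 1 / (2 * real q * real q\<^sub>1)"
    using True q T1 by (intro divide_left_mono) (auto simp: mult_pos_pos)
  moreover have "1 / (real q * real q\<^sub>1) = 2 * (1 / (2 * real q * real q\<^sub>1))" by simp
  moreover have "real q powr (- L) < 1 / (2 * real q * real q\<^sub>1)"
  proof -
    have "2 * real q * real q\<^sub>1 < real q * real q powr (L - 1)" using range(1) q by simp
    also have "\<dots> = real q powr L" using q by (simp add: powr_mult_base)
    finally show ?thesis using q by (simp add: powr_minus field_simps)
  qed
  ultimately show ?thesis using x(1) by linarith
next
  case False
  \<comment> \<open>\<open>D\<close> is a denominator of \<open>p/q + p\<^sub>2/q\<^sub>2\<close>.
    Its distance \<open>D powr (- \<eta>)\<close> from \<open>\<xi>\<close> is split into two halves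
    below.\<close>
  define D where "D = real (q * q\<^sub>2)"
  have D: "D = real q * real q\<^sub>2" "D > 0" using q by (auto simp: D_def)
  have eq: "of_int (p * int q\<^sub>2 + p\<^sub>2 * int q) / of_nat (q * q\<^sub>2) = (of_int p / of_nat q + of_int p\<^sub>2 / of_nat q\<^sub>2 :: real)"
    using q by (simp add: field_simps)
  have main: "D powr (- \<eta>) < \<bar>x - of_int p / of_nat q\<bar> + 1 / T'"
    using xi x(2) unfolding eq D_def by linarith
  have root: "real n \<le> S powr (1 / L)" if "real n powr L \<le> S" for n :: nat and S
  proof -
    have "real n = (real n powr L) powr (1 / L)" using L by (simp add: powr_powr)
    also have "\<dots> \<le> S powr (1 / L)" using that L by (intro powr_mono2) auto
    finally show ?thesis .
  qed
  \<comment> \<open>The upper end of the range bounds \<open>q\<close>, and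
    \<open>q\<^sub>2 powr L \<le> T'\<close> bounds \<open>q\<^sub>2\<close>, both by powers of
    \<open>T'\<close>. By the second threshold the error \<open>1 / T'\<close> uses up at most one
    half.\<close>
  have "2 * D powr \<eta> \<le> T'"
  proof -
    have "real q = (real q powr (L - 1)) powr (1 / (L - 1))" using L by (simp add: powr_powr)
    also have "\<dots> \<le> (2 * c * T') powr (1 / (L - 1))"
      using range(2) qs(2) L by (intro powr_mono2) auto
    finally have "D \<le> (2 * c * T') powr (1 / (L - 1)) * T' powr (1 / L)"
      unfolding D using root[OF T(2)] by (intro mult_mono) auto
    then have "D powr \<eta> \<le> ((2 * c * T') powr (1 / (L - 1)) * T' powr (1 / L)) powr \<eta>"
      using D eta by (intro powr_mono2) auto
    then show ?thesis using thr(2) by linarith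
  qed
  moreover have "D powr \<eta> > 0" using D(2) by (simp only: powr_gt_zero)
  ultimately have half: "1 / T' \<le> D powr (- \<eta>) / 2"
    using T1 unfolding powr_minus by (simp add: field_simps)
  \<comment> \<open>The other half beats \<open>q powr (- L)\<close>: since
    \<open>q\<^sub>1 \<le> T powr (1 / L)\<close>, the failed case condition makes \<open>q\<close>
    exceed \<open>T powr (1 - 1 / L) / 2\<close>, while \<open>q\<^sub>2 \<le> c * T\<close>; the
    first threshold compares the two.\<close>
  have "real q powr (- L) < D powr (- \<eta>) / 2"
  proof -
    have "T powr (1 - 1 / L) / 2 < real q"
    proof -
      have "T = T powr (1 - 1 / L) * T powr (1 / L)"
        using T1 by (simp flip: powr_add)
      moreover have "T < 2 * real q * T powr (1 / L)"
        using False root[OF T(1)] mult_left_mono[of "real q\<^sub>1" "T powr (1 / L)" "2 * real q"] by simp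
      ultimately have "T powr (1 - 1 / L) * T powr (1 / L) < 2 * real q * T powr (1 / L)" by simp
      then have "T powr (1 - 1 / L) < 2 * real q" by (rule mult_right_less_imp_less) simp
      then show ?thesis by simp
    qed
    then have "(T powr (1 - 1 / L) / 2) powr (L - \<eta>) < real q powr (L - \<eta>)"
      using eta by (intro powr_less_mono2) auto
    moreover have "real q\<^sub>2 powr \<eta> \<le> (c * T) powr \<eta>" using qs(1) eta by (intro powr_mono2) auto
    ultimately have "2 * real q\<^sub>2 powr \<eta> < real q powr (L - \<eta>)" using thr(1) by linarith
    then have "real q powr \<eta> * (2 * real q\<^sub>2 powr \<eta>) < real q powr \<eta> * real q powr (L - \<eta>)"
      using q by (intro mult_strict_left_mono) auto
    then have "2 * D powr \<eta> < real q powr L"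
      unfolding D using q by (simp add: powr_mult flip: powr_add)
    then show ?thesis using D q by (simp add: powr_minus field_simps)
  qed
  then show ?thesis using main half by linarith
qed

text \<open>The sequence \<open>z\<close> alternates between the two summands, so the fractions
  whose index has the parity of \<open>i\<close> approximate \<open>z i\<close>. A competitor
  \<open>a/b\<close> is compared with the last such fraction satisfying
  \<open>2 * q n < b powr (L - 1)\<close>: either both are equal as numbers, or
  \<open>no_other_approximation\<close> applies to the indices \<open>n\<close>,
  \<open>n + 1\<close>, \<open>n + 2\<close>.\<close>

lemma exact_approximation:
  fixes L \<eta> c C C' \<xi> T\<^sub>0 :: real and Q\<^sub>0 i :: nat
    and p :: "nat \<Rightarrow> int" and q :: "nat \<Rightarrow> nat" and \<Phi> :: "nat \<Rightarrow> nat \<Rightarrow> real" and z :: "nat \<Rightarrow> real"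
  assumes L: "L > 1" and eta: "0 < \<eta>" "\<eta> < L" and c: "c > 0" and T0: "T\<^sub>0 \<ge> 1"
    and thr: "\<And>T. T \<ge> T\<^sub>0 \<Longrightarrow> 2 * (c * T) powr \<eta> < (T powr (1 - 1 / L) / 2) powr (L - \<eta>)
      \<and> 2 * ((2 * c * T) powr (1 / (L - 1)) * T powr (1 / L)) powr \<eta> \<le> T"
    and C: "0 < C" "C < C'" "C' < 1"
    and xi: "\<And>P Q. Q \<ge> Q\<^sub>0 \<Longrightarrow> \<bar>\<xi> - of_int P / of_nat Q\<bar> > real Q powr (- \<eta>)"
    and Phi_pos: "\<And>n q. q \<ge> 1 \<Longrightarrow> \<Phi> n q > 0"
    and Phi_mono: "\<And>n. antimono_on {1..} (\<Phi> n)"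
    and Phi_le: "\<And>n q. q \<ge> Q\<^sub>0 \<Longrightarrow> \<Phi> n q \<le> real q powr (- L)"
    and Phi_per: "\<And>n. \<Phi> (Suc (Suc n)) = \<Phi> n"
    and q0: "q 0 \<ge> 1" "q 0 \<ge> Q\<^sub>0" "real (q 0) \<ge> T\<^sub>0"
    and cop: "\<And>n. coprime (p n) (int (q n))"
    and q_less: "\<And>n. q n < q (Suc n)"
    and q_le: "\<And>n. real (q (Suc n)) \<le> c / \<Phi> n (q n)"
    and z: "\<And>n. of_int (p n) / of_nat (q n) + C' * \<Phi> n (q n) \<le> z n"
      "\<And>n. z n \<le> of_int (p n) / of_nat (q n) + \<Phi> n (q n)"
    and z_sum: "\<And>n. z n + z (Suc n) = \<xi>"
  shows "z i \<in> exact_approx_set (\<Phi> i) C"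
proof -
  have smono: "strict_mono q" using q_less by (simp add: strict_mono_Suc_iff)
  have q_ge: "q n \<ge> q 0" for n using smono by (simp add: strict_mono_less_eq)
  have q1: "q n \<ge> 1" and qQ: "q n \<ge> Q\<^sub>0" and qT: "real (q n) \<ge> T\<^sub>0" for n
    using q_ge[of n] q0 by (auto intro: order_trans)
  \<comment> \<open>The reciprocal accuracy is the natural scale:
    \<open>q n powr L \<le> T n\<close> and \<open>q (Suc n) \<le> c * T n\<close>.\<close>
  define T where "T n = 1 / \<Phi> n (q n)" for n
  have Phi_T: "\<Phi> n (q n) = 1 / T n" for n by (simp add: T_def)
  have qLT: "real (q n) powr L \<le> T n" for n
    using Phi_le[OF qQ, of n n] Phi_pos[OF q1, of n n] q1[of n] unfolding T_def
    by (simp add: powr_minus field_simps)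
  have TT0: "T n \<ge> T\<^sub>0" for n
  proof -
    have "T\<^sub>0 \<le> real (q n) powr 1" using qT by simp
    also have "\<dots> \<le> real (q n) powr L" using q1[of n] L by (intro powr_mono) auto
    finally show ?thesis using qLT[of n] by linarith
  qed
  \<comment> \<open>Two consecutive instances of \<open>z_sum\<close> cancel, so \<open>z\<close>
    has period two, like \<open>\<Phi>\<close>.\<close>
  have per: "z (i + 2 * k) = z i" "\<Phi> (i + 2 * k) = \<Phi> i" for k
  proof (induction k)
    case (Suc k)
    { case 1 then show ?case using Suc z_sum[of "i + 2 * k"] z_sum[of "Suc (i + 2 * k)"] by simp }
    { case 2 then show ?case using Suc Phi_per[of "i + 2 * k"] by simp }
  qed auto
  have close: "\<bar>z n - of_int (p n) / of_nat (q n)\<bar> \<le> \<Phi> n (q n)" for n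
  proof -
    have "0 \<le> C' * \<Phi> n (q n)" using C Phi_pos[OF q1, of n n] by simp
    then show ?thesis using z[of n] by linarith
  qed
  have far: "C * \<Phi> n (q n) < \<bar>z n - of_int (p n) / of_nat (q n)\<bar>" for n
  proof -
    have "C * \<Phi> n (q n) < C' * \<Phi> n (q n)" using C Phi_pos[OF q1, of n n] by simp
    then show ?thesis using z[of n] by linarith
  qed
  have qk: "strict_mono (\<lambda>k. q (i + 2 * k))"
    using smono by (auto simp: strict_mono_def)
  \<comment> \<open>Reduced fractions with different denominators differ as numbers, which is what
    \<open>approximants\<close> counts.\<close>
  have inj: "inj (\<lambda>n. of_int (p n) / real (q n))"
  proof (rule injI)
    fix m n assume e: "of_int (p m) / real (q m) = of_int (p n) / real (q n)"
    have "of_int (p m * int (q n)) = (of_int (p n * int (q m)) :: real)"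
      using e q1[of m] q1[of n] by (simp add: field_simps)
    then have "p m * int (q n) = p n * int (q m)" by (simp only: of_int_eq_iff)
    then have "int (q m) dvd int (q n)" "int (q n) dvd int (q m)"
      using cop[of m] cop[of n] by (metis coprime_commute coprime_dvd_mult_right_iff dvd_triv_right)+
    then have "q m = q n" by (simp add: dvd_antisym)
    then show "m = n" using smono by (simp add: strict_mono_eq)
  qed
  have "infinite (approximants (\<Phi> i) (z i))"
  proof
    assume "finite (approximants (\<Phi> i) (z i))"
    moreover have "range (\<lambda>k. of_int (p (i + 2 * k)) / real (q (i + 2 * k))) \<subseteq> approximants (\<Phi> i) (z i)"
      using close[of "i + 2 * _"] q1 unfolding approximants_def per by blast
    moreover have "inj (\<lambda>k. of_int (p (i + 2 * k)) / real (q (i + 2 * k)))"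
      using inj unfolding inj_def by (metis add_left_cancel mult_left_cancel zero_neq_numeral)
    ultimately show False using finite_subset range_inj_infinite by blast
  qed
  moreover have "finite (approximants (\<lambda>q. C * \<Phi> i q) (z i))"
  proof -
    \<comment> \<open>Beyond \<open>R\<close> the index \<open>0\<close> belongs to the set
      \<open>K\<close> below, so that its maximum exists.\<close>
    have "eventually (\<lambda>t. (2 * real (q i)) * t powr 0 < 1 * t powr (L - 1)) at_top"
      using L by (intro powr_eventually_less) auto
    then obtain R where R: "\<And>t. t \<ge> R \<Longrightarrow> 2 * real (q i) * t powr 0 < 1 * t powr (L - 1)"
      by (auto simp: eventually_at_top_linorder)
    have excl: "C * \<Phi> i b < \<bar>z i - of_int a / of_nat b\<bar>"
      if b: "b \<ge> Q\<^sub>0 + nat \<lceil>R\<rceil> + 1" for a and b :: nat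
    proof -
      have b1: "b \<ge> 1" "b \<ge> Q\<^sub>0" "real b \<ge> R" using b by linarith+
      \<comment> \<open>Maximality of \<open>k\<close> in \<open>K\<close> yields precisely the two
        range conditions of \<open>no_other_approximation\<close>.\<close>
      define K where "K = {k. 2 * real (q (i + 2 * k)) < real b powr (L - 1)}"
      have "0 \<in> K" using R[OF b1(3)] b1 by (simp add: K_def)
      have "finite K"
      proof (rule finite_subset)
        show "K \<subseteq> {..nat \<lceil>real b powr (L - 1)\<rceil>}"
        proof
          fix k assume "k \<in> K"
          moreover have "k \<le> q (i + 2 * k)" using strict_mono_imp_increasing[OF qk] by simp
          ultimately have "real k \<le> real b powr (L - 1)" by (simp add: K_def)
          then show "k \<in> {..nat \<lceil>real b powr (L - 1)\<rceil>}" by simp linarith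
        qed
      qed simp
      define k where "k = Max K"
      have "k \<in> K" using \<open>finite K\<close> \<open>0 \<in> K\<close> by (auto simp: k_def intro: Max_in)
      have "Suc k \<notin> K" using Max_ge[OF \<open>finite K\<close>, of "Suc k"] by (auto simp: k_def)
      define n where "n = i + 2 * k"
      have range: "2 * real (q n) < real b powr (L - 1)" "real b powr (L - 1) \<le> 2 * real (q (Suc (Suc n)))"
        using \<open>k \<in> K\<close> \<open>Suc k \<notin> K\<close> by (auto simp: K_def n_def)
      have zn: "z n = z i" "\<Phi> n = \<Phi> i" by (simp_all add: n_def per)
      show ?thesis
      proof (cases "of_int a / of_nat b = (of_int (p n) / of_nat (q n) :: real)")
        \<comment> \<open>Here \<open>a/b\<close> may be unreduced. Coprimality gives
          \<open>q n dvd b\<close>, so \<open>\<Phi> i b \<le> \<Phi> i (q n)\<close> by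
          monotonicity, and the strict inequality \<open>far\<close> decides.\<close>
        case True
        have "a * int (q n) = p n * int b"
        proof -
          have "of_int (a * int (q n)) = (of_int (p n * int b) :: real)"
            using True b1 q1[of n] by (simp add: field_simps)
          then show ?thesis by (simp only: of_int_eq_iff)
        qed
        then have "int (q n) dvd int b"
          using cop[of n] by (metis coprime_commute coprime_dvd_mult_right_iff dvd_triv_right)
        then have "q n \<le> b" using b1 by (auto dest: dvd_imp_le)
        then have "\<Phi> i b \<le> \<Phi> i (q n)"
          using Phi_mono[of i] q1[of n] b1 by (auto simp: monotone_on_def)
        then have "C * \<Phi> i b \<le> C * \<Phi> i (q n)" using C by simp
        then show ?thesis using far[of n] True zn by simp
      next
        case False
        have "real b powr (- L) < \<bar>z n - of_int a / of_nat b\<bar>"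
        proof (rule no_other_approximation[where T = "T n" and T' = "T (Suc n)" and ?q\<^sub>3.0 = "q (Suc (Suc n))"])
          have "Q\<^sub>0 \<le> b * q (Suc n)" using b1 q1[of "Suc n"]
            by (metis dual_order.trans mult.right_neutral mult_le_mono2)
          then show "real (b * q (Suc n)) powr - \<eta> < \<bar>\<xi> - real_of_int (a * int (q (Suc n)) + p (Suc n) * int b) / real (b * q (Suc n))\<bar>"
            by (rule xi)
          have "\<xi> - z n = z (Suc n)" using z_sum[of n] by simp
          then show "\<bar>\<xi> - z n - of_int (p (Suc n)) / real (q (Suc n))\<bar> \<le> 1 / T (Suc n)"
            using close[of "Suc n"] by (simp add: Phi_T)
          show "\<bar>z n - of_int (p n) / real (q n)\<bar> \<le> 1 / T n"
            using close[of n] by (simp add: Phi_T)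
          show "real (q (Suc n)) \<le> c * T n" "real (q (Suc (Suc n))) \<le> c * T (Suc n)"
            using q_le[of n] q_le[of "Suc n"] by (simp_all add: T_def)
        qed (use L eta c T0 TT0[of n] TT0[of "Suc n"] thr[OF TT0] b1 q1 qLT range False in auto)
        moreover have "C * \<Phi> i b \<le> 1 * \<Phi> i b" using C Phi_pos[OF b1(1), of i] by (intro mult_right_mono) auto
        ultimately show ?thesis using Phi_le[OF b1(2), of i] zn by simp
      qed
    qed
    show ?thesis
    proof (rule finite_approximantsI)
      fix a and b :: nat assume "b \<ge> Q\<^sub>0 + nat \<lceil>R\<rceil> + 1" "\<bar>z i - of_int a / of_nat b\<bar> \<le> C * \<Phi> i b"
      then show "of_int a / of_nat b \<in> {}" using excl[of b a] by simp
    qed simp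
  qed
  ultimately show ?thesis by (simp add: exact_approx_set_def)
qed

text \<open>The target interval has length \<open>(1 - C') * \<Phi> q\<close>. The new fraction is
  put into its left half, and the new interval fits as soon as \<open>\<Phi>' q' \<le> l\<close>,
  half that length. This holds because \<open>q'\<close> is forced to be large: otherwise
  \<open>p/q + p'/q'\<close> would be too good an approximation of \<open>\<xi>\<close>.\<close>

lemma next_fraction:
  fixes L \<eta> C' \<xi> :: real and p :: int and q :: nat and \<Phi> \<Phi>' :: "nat \<Rightarrow> real"
  assumes L: "L > 1" and eta: "0 < \<eta>" "\<eta> < L" and C': "0 < C'" "C' < 1"
    and xi: "\<And>P Q. Q \<ge> Q\<^sub>0 \<Longrightarrow> \<bar>\<xi> - of_int P / of_nat Q\<bar> > real Q powr (- \<eta>)"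
    and thr: "4 / (1 - C') * (1 / \<Phi> q) \<le> (1 / \<Phi> q) powr (L / \<eta> - 1)"
    and q: "q \<ge> 2" "q \<ge> Q\<^sub>0"
    and Phi: "\<Phi> q > 0" "\<Phi> q \<le> real q powr (- L)"
    and Phi': "\<And>n. n \<ge> q \<Longrightarrow> 0 < \<Phi>' n" "\<And>n. n \<ge> q \<Longrightarrow> \<Phi>' n \<le> real n powr (- L)"
  obtains p' :: int and q' :: nat where "coprime p' (int q')" "q < q'"
    "real q' \<le> 4 / (1 - C') / \<Phi> q"
    "{of_int p' / of_nat q' + C' * \<Phi>' q'..of_int p' / of_nat q' + \<Phi>' q'}
       \<subseteq> {\<xi> - of_int p / of_nat q - \<Phi> q..\<xi> - of_int p / of_nat q - C' * \<Phi> q}"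
proof -
  define T where "T = 1 / \<Phi> q"
  have PhiT: "\<Phi> q = 1 / T" by (simp add: T_def)
  have T0: "T > 0" using Phi by (simp add: T_def)
  have qLT: "real q powr L \<le> T"
    using Phi q unfolding T_def by (simp add: powr_minus field_simps)
  have "1 \<le> real q powr L" using q L by (intro ge_one_powr_ge_zero) auto
  then have T1: "T \<ge> 1" using qLT by linarith
  have qT: "real q \<le> T powr (1 / L)"
  proof -
    have "real q = (real q powr L) powr (1 / L)" using L by (simp add: powr_powr)
    also have "\<dots> \<le> T powr (1 / L)" using qLT L by (intro powr_mono2) auto
    finally show ?thesis .
  qed
  have thr': "4 / (1 - C') * T \<le> T powr (L / \<eta> - 1)" using thr by (simp add: T_def)
  have T2: "T > 1"
  proof -
    have "1 < real q powr L" using q L by (intro gr_one_powr) auto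
    then show ?thesis using qLT by linarith
  qed
  \<comment> \<open>Half the target length; the denominator bound \<open>2 / l\<close> is the source
    of the constant \<open>4 / (1 - C')\<close>.\<close>
  define l where "l = (1 - C') * \<Phi> q / 2"
  have l: "0 < l" "l \<le> 1"
  proof -
    have "(1 - C') * \<Phi> q \<le> 1 * 1" using C' Phi T1 by (intro mult_mono) (auto simp: PhiT)
    then show "0 < l" "l \<le> 1" using C' Phi by (auto simp: l_def)
  qed
  obtain p' q' where pq: "q' \<ge> 1" "coprime p' (int q')"
      "\<xi> - of_int p / of_nat q - \<Phi> q \<le> of_int p' / of_nat q'"
      "of_int p' / of_nat q' \<le> \<xi> - of_int p / of_nat q - \<Phi> q + l" "of_nat q' \<le> 2 / l"
    using fraction_in_interval[OF l] by blast
  have q'_le: "real q' \<le> 4 / (1 - C') / \<Phi> q" using pq(5) by (simp add: l_def)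
  \<comment> \<open>The sum of both fractions lies within \<open>\<Phi> q = 1 / T\<close> of
    \<open>\<xi>\<close>, so its denominator cannot be small.\<close>
  have T_less: "T < (real q * real q') powr \<eta>"
  proof -
    have "Q\<^sub>0 \<le> q * q'" using q pq by (metis dual_order.trans mult.right_neutral mult_le_mono2)
    from xi[OF this, of "p * int q' + p' * int q"]
    have "(real q * real q') powr (- \<eta>) < \<bar>\<xi> - (of_int p / of_nat q + of_int p' / of_nat q')\<bar>"
      using q pq by (simp add: field_simps)
    also have "\<dots> \<le> \<Phi> q"
    proof -
      have "(1 - C') * \<Phi> q \<le> 1 * \<Phi> q" using C' Phi by (intro mult_right_mono) auto
      then have "l \<le> \<Phi> q" using Phi by (simp add: l_def)
      then show ?thesis using pq(3,4) Phi by linarith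
    qed
    finally have "1 / (real q * real q') powr \<eta> < 1 / T" by (simp add: PhiT powr_minus field_simps)
    then show ?thesis using T0 q pq by (simp add: field_simps)
  qed
  have "T powr (1 / \<eta>) < real q * real q'"
  proof -
    have "T powr (1 / \<eta>) < ((real q * real q') powr \<eta>) powr (1 / \<eta>)"
      using T_less T0 eta by (intro powr_less_mono2) auto
    then show ?thesis using eta by (simp add: powr_powr)
  qed
  also have "\<dots> \<le> T powr (1 / L) * real q'" using qT by (intro mult_right_mono) auto
  finally have "T powr (1 / L) * T powr (1 / \<eta> - 1 / L) < T powr (1 / L) * real q'"
    by (simp flip: powr_add)
  then have q'_gr: "T powr (1 / \<eta> - 1 / L) < real q'" using T0 by simp
  \<comment> \<open>As \<open>4 / (1 - C') > 1\<close> and \<open>T > 1\<close>, the threshold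
    forces \<open>L / \<eta> - 1 > 1\<close>.\<close>
  have eta2: "1 / L < 1 / \<eta> - 1 / L"
  proof -
    have "T powr 1 < T powr (L / \<eta> - 1)"
    proof -
      have "1 * T < 4 / (1 - C') * T" using C' T0 by (intro mult_strict_right_mono) (auto simp: field_simps)
      then show ?thesis using thr' T0 by simp
    qed
    then have "1 < L / \<eta> - 1" using T2 by (simp only: powr_less_cancel_iff)
    then show ?thesis using L eta by (simp add: field_simps)
  qed
  have q_less: "q < q'"
  proof -
    have "T powr (1 / L) \<le> T powr (1 / \<eta> - 1 / L)" using eta2 T1 by (intro powr_mono) auto
    then show ?thesis using qT q'_gr by linarith
  qed
  \<comment> \<open>Raising \<open>q' > T powr (1 / \<eta> - 1 / L)\<close> to the power
    \<open>L\<close> produces the exponent \<open>L / \<eta> - 1\<close> of the threshold.\<close>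
  have Phi'_le: "\<Phi>' q' \<le> l"
  proof -
    have "(T powr (1 / \<eta> - 1 / L)) powr L \<le> real q' powr L"
      using q'_gr L by (intro powr_mono2) auto
    moreover have "(1 / \<eta> - 1 / L) * L = L / \<eta> - 1" using L by (simp add: field_simps)
    ultimately have "T powr (L / \<eta> - 1) \<le> real q' powr L" by (simp add: powr_powr)
    then have "4 / (1 - C') * T \<le> real q' powr L" using thr' by linarith
    moreover have "4 / (1 - C') * T = 2 / l" using C' by (simp add: l_def T_def)
    ultimately have "2 / l \<le> real q' powr L" by simp
    then have "real q' powr (- L) \<le> l / 2"
      using l pq(1) unfolding powr_minus by (simp add: field_simps)
    then show ?thesis using Phi'(2)[of q'] q_less l by linarith
  qed
  have "0 < C' * \<Phi>' q'" using C' Phi'(1)[of q'] q_less by simp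
  moreover have "\<Phi> q - 2 * l = C' * \<Phi> q" by (simp add: l_def field_simps)
  ultimately have "{of_int p' / of_nat q' + C' * \<Phi>' q'..of_int p' / of_nat q' + \<Phi>' q'}
       \<subseteq> {\<xi> - of_int p / of_nat q - \<Phi> q..\<xi> - of_int p / of_nat q - C' * \<Phi> q}"
    using pq(3,4) Phi'_le by auto
  then show thesis using that pq(2) q_less q'_le by blast
qed

text \<open>Fractions are chosen recursively so that each window, reflected by \<open>y\<close> to
  \<open>\<xi> - y\<close>, lies in the preceding one. Pulled back to one coordinate, the windows
  are nested compact intervals, and any common point \<open>x\<close> gives the decomposition
  \<open>x + (\<xi> - x)\<close>.\<close>

lemma W2_subset_sumset:
  fixes C L :: real and \<Phi>\<^sub>0 \<Phi>\<^sub>1 :: "nat \<Rightarrow> real"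
  assumes C: "0 < C" "C < 1" and L: "L > (5 + sqrt 17) / 2"
    and Phi0: "\<forall>q\<ge>1. \<Phi>\<^sub>0 q > 0" "antimono_on {1..} \<Phi>\<^sub>0" "\<exists>q\<^sub>0. \<forall>q\<ge>q\<^sub>0. \<Phi>\<^sub>0 q \<le> real q powr (- L)"
    and Phi1: "\<forall>q\<ge>1. \<Phi>\<^sub>1 q > 0" "antimono_on {1..} \<Phi>\<^sub>1" "\<exists>q\<^sub>0. \<forall>q\<ge>q\<^sub>0. \<Phi>\<^sub>1 q \<le> real q powr (- L)"
  shows "W2 \<subseteq> exact_approx_set \<Phi>\<^sub>0 C + exact_approx_set \<Phi>\<^sub>1 C"
proof
  fix \<xi> assume xiW: "\<xi> \<in> W2"
  have "sqrt 17 > sqrt 16" by (rule real_sqrt_less_mono) simp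
  then have L4: "L > 4" using L by simp
  \<comment> \<open>Completing the square: this is four times \<open>L * L - 5 * L + 2 > 0\<close>,
    and it makes room for \<open>\<eta>\<close> strictly above \<open>2\<close>.\<close>
  have "17 < (2 * L - 5)\<^sup>2"
  proof -
    have "(sqrt 17)\<^sup>2 < (2 * L - 5)\<^sup>2" using L by (intro power_strict_mono) auto
    then show ?thesis by simp
  qed
  then have "2 * (2 * L - 1) < L * (L - 1)" by (simp add: power2_eq_square algebra_simps)
  then have "2 < L * (L - 1) / (2 * L - 1)" using L4 by (simp add: field_simps)
  then obtain \<eta> where eta: "2 < \<eta>" "\<eta> < L * (L - 1) / (2 * L - 1)" using dense by blast
  have "L * (L - 1) \<le> L * (2 * L - 1)" using L4 by (intro mult_left_mono) auto
  then have "L * (L - 1) / (2 * L - 1) \<le> L" using L4 by (simp add: field_simps)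
  then have etaL: "\<eta> < L" using eta by linarith
  obtain Q1 where Q1: "\<And>P Q. Q \<ge> Q1 \<Longrightarrow> \<bar>\<xi> - of_int P / of_nat Q\<bar> > real Q powr (- \<eta>)"
    using W2_dist_gt[OF xiW eta(1)] by blast
  obtain Q2 where Q2: "\<And>q. q \<ge> Q2 \<Longrightarrow> \<Phi>\<^sub>0 q \<le> real q powr (- L)" using Phi0(3) by blast
  obtain Q3 where Q3: "\<And>q. q \<ge> Q3 \<Longrightarrow> \<Phi>\<^sub>1 q \<le> real q powr (- L)" using Phi1(3) by blast
  define Q0 where "Q0 = Max {2, Q1, Q2, Q3}"
  have Q0: "Q0 \<ge> 2" "Q0 \<ge> Q1" "Q0 \<ge> Q2" "Q0 \<ge> Q3" by (auto simp: Q0_def)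
  \<comment> \<open>A constant strictly between \<open>C\<close> and \<open>1\<close>: closed
    windows can be used, and the distances still exceed \<open>C * \<Phi>\<close> strictly.\<close>
  define C' where "C' = (1 + C) / 2"
  have C': "C < C'" "C' < 1" "0 < C'" using C by (auto simp: C'_def)
  define c where "c = 4 / (1 - C')"
  have "c > 0" using C' by (simp add: c_def)
  obtain T0 where T0: "T0 \<ge> 1"
    and thr: "\<And>T. T \<ge> T0 \<Longrightarrow> 2 * (c * T) powr \<eta> < (T powr (1 - 1 / L) / 2) powr (L - \<eta>)
     \<and> 2 * ((2 * c * T) powr (1 / (L - 1)) * T powr (1 / L)) powr \<eta> \<le> T
     \<and> c * T \<le> T powr (L / \<eta> - 1)"
    using exponent_thresholds[OF \<open>c > 0\<close>, of L \<eta>] L4 eta by auto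
  define N where "N = Q0 + nat \<lceil>T0\<rceil>"
  have N: "N \<ge> Q0" "real N \<ge> T0" unfolding N_def by linarith+
  define \<Phi> where "\<Phi> n = (if even n then \<Phi>\<^sub>0 else \<Phi>\<^sub>1)" for n :: nat
  have Phi: "\<And>n q. q \<ge> 1 \<Longrightarrow> \<Phi> n q > 0" "\<And>n. antimono_on {1..} (\<Phi> n)"
    "\<And>n q. q \<ge> Q0 \<Longrightarrow> \<Phi> n q \<le> real q powr (- L)"
    using Phi0 Phi1 Q2 Q3 Q0 by (auto simp: \<Phi>_def)
  define I where "I n s = {of_int (fst s) / real (snd s) + C' * \<Phi> n (snd s)..of_int (fst s) / real (snd s) + \<Phi> n (snd s)}"
    for n and s :: "int \<times> nat"
  \<comment> \<open>A state is a pair of numerator and denominator. The recursion starts at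
    \<open>1/N\<close>, with \<open>N\<close> beyond all thresholds.\<close>
  have "\<exists>s. \<forall>n. (coprime (fst (s n)) (int (snd (s n))) \<and> snd (s n) \<ge> N \<and> (n = 0 \<longrightarrow> snd (s n) = N)) \<and>
     (snd (s n) < snd (s (Suc n)) \<and> real (snd (s (Suc n))) \<le> c / \<Phi> n (snd (s n))
       \<and> (\<forall>y\<in>I (Suc n) (s (Suc n)). \<xi> - y \<in> I n (s n)))"
  proof (rule dependent_nat_choice)
    show "\<exists>s::int \<times> nat. coprime (fst s) (int (snd s)) \<and> N \<le> snd s \<and> (0 = (0::nat) \<longrightarrow> snd s = N)"
      by (intro exI[of _ "(1, N)"]) simp
  next
    fix s :: "int \<times> nat" and n :: nat
    assume s: "coprime (fst s) (int (snd s)) \<and> N \<le> snd s \<and> (n = 0 \<longrightarrow> snd s = N)"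
    define p q where "p = fst s" and "q = snd s"
    have q: "q \<ge> N" "q \<ge> 2" "q \<ge> Q0" "q \<ge> 1" "real q \<ge> T0"
      using s N Q0 by (auto simp: q_def)
    have "1 / \<Phi> n q \<ge> T0"
    proof -
      have "real q powr 1 \<le> real q powr L" using q L4 by (intro powr_mono) auto
      also have "\<dots> \<le> 1 / \<Phi> n q"
        using Phi(1)[OF q(4), of n] Phi(3)[OF q(3), of n] q by (simp add: powr_minus field_simps)
      finally show ?thesis using q by simp
    qed
    then have "4 / (1 - C') * (1 / \<Phi> n q) \<le> (1 / \<Phi> n q) powr (L / \<eta> - 1)"
      using thr unfolding c_def by blast
    then obtain p' q' where "coprime p' (int q')" "q < q'" "real q' \<le> 4 / (1 - C') / \<Phi> n q"
       "{of_int p' / of_nat q' + C' * \<Phi> (Suc n) q'..of_int p' / of_nat q' + \<Phi> (Suc n) q'}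
         \<subseteq> {\<xi> - of_int p / of_nat q - \<Phi> n q..\<xi> - of_int p / of_nat q - C' * \<Phi> n q}"
      using next_fraction[of L \<eta> C' Q0 \<xi> "\<Phi> n" q "\<Phi> (Suc n)" p] L4 eta etaL C' Q1 Q0 q
        Phi(1)[of _ n] Phi(1)[of _ "Suc n"] Phi(3)[of _ n] Phi(3)[of _ "Suc n"]
      by (smt (verit) order_trans)
    then show "\<exists>t. (coprime (fst t) (int (snd t)) \<and> N \<le> snd t \<and> (Suc n = 0 \<longrightarrow> snd t = N)) \<and>
      snd s < snd t \<and> real (snd t) \<le> c / \<Phi> n (snd s) \<and> (\<forall>y\<in>I (Suc n) t. \<xi> - y \<in> I n s)"
      using q by (intro exI[of _ "(p', q')"]) (force simp: I_def c_def p_def q_def)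
  qed
  then obtain s where s: "\<And>n. coprime (fst (s n)) (int (snd (s n)))" "\<And>n. snd (s n) \<ge> N" "snd (s 0) = N"
      "\<And>n. snd (s n) < snd (s (Suc n))" "\<And>n. real (snd (s (Suc n))) \<le> c / \<Phi> n (snd (s n))"
      "\<And>n y. y \<in> I (Suc n) (s (Suc n)) \<Longrightarrow> \<xi> - y \<in> I n (s n)"
    by blast
  \<comment> \<open>Expresses the \<open>n\<close>-th summand through \<open>x\<close>, so that all
    windows become conditions on the same real.\<close>
  define w where "w n x = (if even n then x else \<xi> - x)" for n :: nat and x
  define J where "J n = {x. w n x \<in> I n (s n)}" for n
  have "\<Inter>(range J) \<noteq> {}"
  proof (rule compact_nest)
    \<comment> \<open>Since \<open>w n\<close> is an involution, the preimage is also an image, and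
      compactness carries over.\<close>
    have Jeq: "J n = w n ` I n (s n)" for n by (force simp: J_def w_def)
    show "compact (J n)" for n unfolding Jeq
      by (cases "even n") (auto simp: w_def I_def intro!: compact_continuous_image continuous_intros)
    show "J n \<noteq> {}" for n
    proof -
      have "snd (s n) \<ge> 1" using s(2)[of n] N Q0 by linarith
      then have "C' * \<Phi> n (snd (s n)) \<le> 1 * \<Phi> n (snd (s n))"
        using C' Phi(1)[of "snd (s n)" n] by (intro mult_right_mono) auto
      then show ?thesis unfolding Jeq by (simp add: I_def)
    qed
    have "J (Suc n) \<subseteq> J n" for n
    proof
      fix x assume "x \<in> J (Suc n)"
      then have "\<xi> - w (Suc n) x \<in> I n (s n)" by (intro s(6)) (simp add: J_def)
      then show "x \<in> J n" by (simp add: J_def w_def split: if_splits)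
    qed
    then show "J n \<subseteq> J m" if "m \<le> n" for m n
      using that by (metis lift_Suc_antimono_le)
  qed
  then obtain x where x: "\<And>n. w n x \<in> I n (s n)" by (auto simp: J_def)
  have "w i x \<in> exact_approx_set (\<Phi> i) C" for i
  proof (rule exact_approximation[where L = L and \<eta> = \<eta> and c = c and C' = C' and T\<^sub>0 = T0 and Q\<^sub>0 = Q0
        and p = "\<lambda>n. fst (s n)" and q = "\<lambda>n. snd (s n)" and \<Phi> = \<Phi> and z = "\<lambda>n. w n x" and \<xi> = \<xi>])
    show "of_int (fst (s n)) / real (snd (s n)) + C' * \<Phi> n (snd (s n)) \<le> w n x"
         "w n x \<le> of_int (fst (s n)) / real (snd (s n)) + \<Phi> n (snd (s n))" for n
      using x[of n] by (auto simp: I_def)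
    show "w n x + w (Suc n) x = \<xi>" for n by (simp add: w_def)
    show "\<Phi> (Suc (Suc n)) = \<Phi> n" for n by (simp add: \<Phi>_def)
  qed (use L4 eta etaL C C' T0 N Q0 Q1 Phi s thr \<open>c > 0\<close> in auto)
  from this[of 0] this[of 1] have "x \<in> exact_approx_set \<Phi>\<^sub>0 C" "\<xi> - x \<in> exact_approx_set \<Phi>\<^sub>1 C"
    by (simp_all add: w_def \<Phi>_def)
  then show "\<xi> \<in> exact_approx_set \<Phi>\<^sub>0 C + exact_approx_set \<Phi>\<^sub>1 C"
    using set_plus_intro[of x _ "\<xi> - x"] by fastforce
qed

section \<open>Almost every real has irrationality exponent 2\<close>

text \<open>Borel-Cantelli for the unions of intervals of radius \<open>r q\<close> around
  \<open>F q\<close>: their measures are at most \<open>f q\<close>, and \<open>E\<close> lies in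
  their limsup.\<close>

lemma negligible_infinitely_often:
  fixes F :: "nat \<Rightarrow> real set" and r f :: "nat \<Rightarrow> real"
  assumes F: "\<And>q. q \<ge> N \<Longrightarrow> finite (F q)" "\<And>q. q \<ge> N \<Longrightarrow> real (card (F q)) * (2 * r q) \<le> f q"
    and r: "\<And>q. q \<ge> N \<Longrightarrow> 0 \<le> r q" and f: "summable f"
    and E: "\<And>x. x \<in> E \<Longrightarrow> infinite {q. \<exists>a\<in>F q. \<bar>x - a\<bar> \<le> r q}"
  shows "negligible E"
proof -
  define A where "A q = (if q \<ge> N then (\<Union>a\<in>F q. cball a (r q)) else {})" for q
  have lm: "A q \<in> lmeasurable" for q
    using F(1)[of q] by (auto simp: A_def intro!: fmeasurable.finite_UN lmeasurable_cball)
  have bound: "measure lebesgue (A q) \<le> f q" if "q \<ge> N" for q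
  proof -
    have "measure lebesgue (\<Union>a\<in>F q. cball a (r q)) \<le> (\<Sum>a\<in>F q. measure lebesgue (cball a (r q)))"
      using F(1)[OF that] by (intro measure_UNION_le) auto
    also have "\<dots> = (\<Sum>a\<in>F q. 2 * r q)"
      using r[OF that] by (intro sum.cong) (auto simp: cball_eq_atLeastAtMost)
    also have "\<dots> \<le> f q" using F(2)[OF that] by simp
    finally show ?thesis using that by (simp add: A_def)
  qed
  have "limsup A \<in> null_sets lebesgue"
  proof (rule borel_cantelli_limsup1)
    show "A n \<in> sets lebesgue" for n using lm by (rule fmeasurableD)
    show "emeasure lebesgue (A n) < \<infinity>" for n using fmeasurableD2[OF lm[of n]] by (simp only: less_top infinity_ennreal_def)
    show "summable (\<lambda>n. measure lebesgue (A n))"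
      by (rule summable_comparison_test'[OF f, of N]) (auto intro: bound)
  qed
  moreover have "E \<subseteq> limsup A"
  proof
    fix x assume x: "x \<in> E"
    have "\<exists>m\<ge>n. x \<in> A m" for n
    proof -
      have "infinite ({q. \<exists>a\<in>F q. \<bar>x - a\<bar> \<le> r q} - {..<n + N})"
        using E[OF x] by (rule Diff_infinite_finite[rotated]) simp
      then have "{q. \<exists>a\<in>F q. \<bar>x - a\<bar> \<le> r q} - {..<n + N} \<noteq> {}"
        by (rule infinite_imp_nonempty)
      then obtain q where q': "q \<in> {q. \<exists>a\<in>F q. \<bar>x - a\<bar> \<le> r q} - {..<n + N}" by blast
      then obtain a where a: "a \<in> F q" "\<bar>x - a\<bar> \<le> r q" by blast
      have q: "q \<ge> n" "q \<ge> N" using q' by auto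
      have "x \<in> cball a (r q)" using a(2) by (simp add: dist_real_def abs_minus_commute)
      then have "x \<in> A q" using a(1) q(2) by (auto simp: A_def)
      then show ?thesis using q(1) by blast
    qed
    then show "x \<in> limsup A" by (auto simp: limsup_INF_SUP)
  qed
  ultimately show ?thesis unfolding negligible_iff_null_sets[symmetric] by (rule negligible_subset)
qed

text \<open>Passes from counting rational values to counting denominators, as Borel-Cantelli
  requires; each denominator admits only finitely many numerators.\<close>

lemma infinite_approximantsD:
  assumes "infinite (approximants \<psi> \<xi>)"
  shows "infinite {q. q \<ge> 1 \<and> (\<exists>p::int. \<bar>\<xi> - of_int p / real q\<bar> \<le> \<psi> q)}" (is "infinite ?Q")
proof
  assume "finite ?Q"
  then obtain N where N: "\<And>q. q \<in> ?Q \<Longrightarrow> q < N" by (auto simp: finite_nat_set_iff_bounded)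
  have "finite (approximants \<psi> \<xi>)"
    using N by (intro finite_approximantsI[of N _ _ "{}"]) force+
  then show False using assms by simp
qed

lemma numerator_range:
  fixes p m :: int and q :: nat and \<xi> :: real
  assumes "q \<ge> 1" "of_int m \<le> \<xi>" "\<xi> \<le> of_int m + 1" "\<bar>\<xi> - of_int p / real q\<bar> \<le> r" "r \<le> 1 / real q"
  shows "p \<in> {m * int q - 1..(m + 1) * int q + 1}"
proof -
  have d: "\<bar>\<xi> - of_int p / real q\<bar> \<le> 1 / real q" using assms(4,5) by linarith
  have "of_int p / real q \<le> of_int m + 1 + 1 / real q" "of_int m - 1 / real q \<le> of_int p / real q"
    using d assms(2,3) by linarith+
  then have "of_int p \<le> (of_int m + 1 + 1 / real q) * real q" "(of_int m - 1 / real q) * real q \<le> of_int p"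
    using assms(1) by (simp_all add: pos_divide_le_eq pos_le_divide_eq)
  then have "of_int p \<le> (of_int ((m + 1) * int q + 1) :: real)" "of_int (m * int q - 1) \<le> (of_int p :: real)"
    using assms(1) by (simp_all add: distrib_right left_diff_distrib)
  then show ?thesis by (simp only: of_int_le_iff atLeastAtMost_iff)
qed

text \<open>Dirichlet's theorem in the form of an infinite \<open>approx_set\<close>; its pairs are
  coprime with positive denominator, so distinct pairs have distinct values.\<close>

lemma infinite_approximants_2:
  assumes "\<xi> \<notin> \<rat>"
  shows "infinite (approximants (\<lambda>q. real q powr (- 2)) \<xi>)"
proof
  assume fin: "finite (approximants (\<lambda>q. real q powr (- 2)) \<xi>)"
  have inf: "infinite (approx_set \<xi>)" using assms rational_iff_finite_approx_set by blast
  have "inj_on (\<lambda>(h, k). of_int h / of_int k :: real) (approx_set \<xi>)"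
  proof (rule inj_onI, clarify)
    fix h k h' k' :: int
    assume hk: "(h, k) \<in> approx_set \<xi>" "(h', k') \<in> approx_set \<xi>"
      and e: "of_int h / of_int k = (of_int h' / of_int k' :: real)"
    have pos: "k > 0" "k' > 0" "coprime h k" "coprime h' k'" using hk by (auto simp: approx_set_def)
    have "of_int (h * k') = (of_int (h' * k) :: real)" using e pos by (simp add: field_simps)
    then have eq: "h * k' = h' * k" by (simp only: of_int_eq_iff)
    then have "k dvd k'" "k' dvd k"
      using pos by (metis coprime_commute coprime_dvd_mult_right_iff dvd_triv_right)+
    then have "k = k'" using pos by (simp add: zdvd_antisym_nonneg)
    then show "h = h' \<and> k = k'" using eq pos by simp
  qed
  moreover have "(\<lambda>(h, k). of_int h / of_int k :: real) ` approx_set \<xi> \<subseteq> approximants (\<lambda>q. real q powr (- 2)) \<xi>"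
  proof clarify
    fix h k assume hk: "(h, k) \<in> approx_set \<xi>"
    then have "k > 0" "\<bar>\<xi> - of_int h / of_int k\<bar> \<le> of_int k powr (- 2)"
      by (auto simp: approx_set_def powr_minus powr_numeral divide_inverse)
    then show "of_int h / of_int k \<in> approximants (\<lambda>q. real q powr (- 2)) \<xi>"
      unfolding approximants_def by (intro CollectI exI[of _ h] exI[of _ "nat k"]) auto
  qed
  ultimately show False using fin inf by (meson finite_imageD finite_subset)
qed

text \<open>The convergence half of Khinchin's theorem handles exponents above \<open>2\<close>;
  Dirichlet's theorem gives at least \<open>2\<close> outside the null set of rationals.\<close>

lemma negligible_compl_W2: "negligible ({0..1} - W2)"
proof -
  \<comment> \<open>The exponents \<open>2 + 1 / real (Suc k)\<close> reduce all exponents above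
    \<open>2\<close> to countably many sets.\<close>
  define E where "E k = {\<xi> \<in> {0..1}. infinite (approximants (\<lambda>q. real q powr (- (2 + 1 / real (Suc k)))) \<xi>)}" for k
  have "negligible (E k)" for k
  proof -
    define \<mu> where "\<mu> = 2 + 1 / real (Suc k)"
    have mu: "\<mu> > 2" by (simp add: \<mu>_def)
    show ?thesis
    proof (rule negligible_infinitely_often[where N = 1
          and F = "\<lambda>q. (\<lambda>p. of_int p / real q) ` {0 * int q - 1..(0 + 1) * int q + 1}"
          and r = "\<lambda>q. real q powr (- \<mu>)" and f = "\<lambda>q. 8 * real q powr (1 - \<mu>)"])
      fix q :: nat assume q: "q \<ge> 1"
      \<comment> \<open>There are at most \<open>q + 3 \<le> 4 * q\<close> centres, each with an
        interval of length \<open>2 * q powr (- \<mu>)\<close>; the total is summable because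
        \<open>\<mu> > 2\<close>.\<close>
      have "card ((\<lambda>p. of_int p / real q) ` {0 * int q - 1..(0 + 1) * int q + 1}) \<le> q + 3"
        using card_image_le[of "{0 * int q - 1..(0 + 1) * int q + 1}" "\<lambda>p. of_int p / real q"] by simp
      then have "real (card ((\<lambda>p. of_int p / real q) ` {0 * int q - 1..(0 + 1) * int q + 1})) \<le> 4 * real q"
        using q by linarith
      then have "real (card ((\<lambda>p. of_int p / real q) ` {0 * int q - 1..(0 + 1) * int q + 1})) * (2 * real q powr (- \<mu>))
          \<le> (4 * real q) * (2 * real q powr (- \<mu>))" by (intro mult_right_mono) auto
      also have "\<dots> = 8 * real q powr (1 - \<mu>)"
        using q by (simp add: powr_mult_base)
      finally show "real (card ((\<lambda>p. of_int p / real q) ` {0 * int q - 1..(0 + 1) * int q + 1})) * (2 * real q powr (- \<mu>))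
          \<le> 8 * real q powr (1 - \<mu>)" .
    next
      show "summable (\<lambda>q. 8 * real q powr (1 - \<mu>))"
        using mu by (intro summable_mult) (simp add: summable_real_powr_iff)
    next
      fix x assume x: "x \<in> E k"
      then have "infinite {q. q \<ge> 1 \<and> (\<exists>p::int. \<bar>x - of_int p / real q\<bar> \<le> real q powr (- \<mu>))}"
        unfolding E_def \<mu>_def by (intro infinite_approximantsD) auto
      moreover have "\<exists>a\<in>(\<lambda>p. of_int p / real q) ` {0 * int q - 1..(0 + 1) * int q + 1}. \<bar>x - a\<bar> \<le> real q powr (- \<mu>)"
        if q: "q \<ge> 1" and p: "\<bar>x - of_int p / real q\<bar> \<le> real q powr (- \<mu>)" for p :: int and q :: nat
      proof -
        have "real q powr (- \<mu>) \<le> real q powr (- 1)" using q mu by (intro powr_mono) auto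
        then have "real q powr (- \<mu>) \<le> 1 / real q" using q by (simp add: powr_minus field_simps)
        then have "p \<in> {0 * int q - 1..(0 + 1) * int q + 1}"
          using x q p by (intro numerator_range[of q 0 x]) (auto simp: E_def)
        then show ?thesis using p by blast
      qed
      ultimately show "infinite {q. \<exists>a\<in>(\<lambda>p. of_int p / real q) ` {0 * int q - 1..(0 + 1) * int q + 1}. \<bar>x - a\<bar> \<le> real q powr (- \<mu>)}"
        by (elim infinite_super[rotated]) blast
    qed auto
  qed
  then have "negligible (\<Union>k. E k)"
    by (intro negligible_countable_Union) auto
  moreover have "negligible (\<rat> :: real set)"
    unfolding negligible_iff_null_sets
    by (intro null_sets_completionI countable_imp_null_set_lborel countable_rat)
  ultimately have "negligible (\<rat> \<union> (\<Union>k. E k))"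
    by (intro negligible_Un)
  moreover have "{0..1} - W2 \<subseteq> \<rat> \<union> (\<Union>k. E k)"
  proof
    fix \<xi> :: real assume xi: "\<xi> \<in> {0..1} - W2"
    show "\<xi> \<in> \<rat> \<union> (\<Union>k. E k)"
    proof (rule ccontr)
      assume n: "\<xi> \<notin> \<rat> \<union> (\<Union>k. E k)"
      then have "ereal 2 \<le> irrationality_exponent \<xi>"
        using infinite_approximants_2 unfolding irrationality_exponent_def by (intro Sup_upper) auto
      moreover have "irrationality_exponent \<xi> \<le> 2"
        unfolding irrationality_exponent_def
      proof (rule Sup_least, clarify)
        fix \<mu> :: real assume inf: "infinite (approximants (\<lambda>q. real q powr (- \<mu>)) \<xi>)"
        show "ereal \<mu> \<le> 2"
        proof (rule ccontr)
          assume "\<not> ereal \<mu> \<le> 2"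
          then have "\<mu> - 2 > 0" by simp
          then obtain k where k: "1 / real (Suc k) < \<mu> - 2" using nat_approx_posE by blast
          have "real q powr (- \<mu>) \<le> real q powr (- (2 + 1 / real (Suc k)))" if "q \<ge> 1" for q
            using that k by (intro powr_mono) auto
          then have "approximants (\<lambda>q. real q powr (- \<mu>)) \<xi> \<subseteq> approximants (\<lambda>q. real q powr (- (2 + 1 / real (Suc k)))) \<xi>"
            unfolding approximants_def by (blast intro: order_trans)
          then have "\<xi> \<in> E k" using inf xi unfolding E_def by (blast dest: finite_subset)
          then show False using n by blast
        qed
      qed
      ultimately have "\<xi> \<in> W2" by (simp add: W2_def order_antisym)
      then show False using xi by simp
    qed
  qed
  ultimately show ?thesis using negligible_subset by blast
qed

lemma not_negligible_W2: "\<not> negligible W2"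
proof
  assume "negligible W2"
  then have "negligible (W2 \<union> ({0..1} - W2))" using negligible_compl_W2 by (rule negligible_Un)
  then have "negligible {0..1::real}" by (rule negligible_subset) auto
  then show False using negligible_interval(1)[of "0::real" 1] by (simp add: cbox_interval)
qed

section \<open>Hausdorff dimension\<close>

lemma ennreal_eq_0_if_le_tendsto:
  assumes "\<And>h. 0 < h \<Longrightarrow> h \<le> \<delta> \<Longrightarrow> a \<le> ennreal (g h)" "(g \<longlongrightarrow> 0) (at_right 0)" "(0::real) < \<delta>"
  shows "a = 0"
proof -
  have "((\<lambda>h. ennreal (g h)) \<longlongrightarrow> ennreal 0) (at_right 0)"
    using assms(2) by (intro tendsto_ennrealI)
  moreover have "eventually (\<lambda>h. a \<le> ennreal (g h)) (at_right 0)"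
    using assms(1,3) by (auto simp: eventually_at_right_field intro!: exI[of _ \<delta>])
  ultimately have "a \<le> ennreal 0" by (intro tendsto_lowerbound) auto
  then show ?thesis by simp
qed

text \<open>For \<open>d \<le> 1\<close> and \<open>s < 1\<close> one has
  \<open>d \<le> d powr s\<close>, so a cover with small \<open>s\<close>-sum also has small total
  length.\<close>

lemma negligible_if_hausdorff_measure_0:
  fixes A :: "real set"
  assumes "0 < s" "s < 1" "hausdorff_measure s A = 0"
  shows "negligible A"
proof (rule negligible_outer_le[THEN iffD2, rule_format])
  fix e :: real assume e: "e > 0"
  have "hausdorff_premeasure s 1 A \<le> hausdorff_measure s A"
    unfolding hausdorff_measure_def by (rule SUP_upper) auto
  then have "hausdorff_premeasure s 1 A < ennreal (e / 2)" using assms e by simp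
  then obtain U :: "nat \<Rightarrow> real set" where U: "A \<subseteq> (\<Union>i. U i)" "\<And>i. bounded (U i)" "\<And>i. diameter (U i) \<le> 1"
     "(\<Sum>i. ennreal (diameter (U i) powr s)) < ennreal (e / 2)"
    unfolding hausdorff_premeasure_def Inf_less_iff by auto
  \<comment> \<open>The sets \<open>U i\<close> may be non-measurable, so each is enclosed in an
    interval of twice its diameter; hence the \<open>e / 2\<close> above. For empty
    \<open>U i\<close> the centre is arbitrary and harmless.\<close>
  define V where "V i = cball (SOME x. x \<in> U i) (diameter (U i))" for i
  have UV: "U i \<subseteq> V i" for i
  proof
    fix y assume y: "y \<in> U i"
    then have "(SOME x. x \<in> U i) \<in> U i" by (rule someI)
    then show "y \<in> V i" using diameter_bounded_bound[OF U(2)] y by (auto simp: V_def)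
  qed
  have "emeasure lebesgue (V i) \<le> 2 * ennreal (diameter (U i) powr s)" for i
  proof -
    have d: "0 \<le> diameter (U i)" using U(2) by (rule diameter_ge_0)
    have "diameter (U i) \<le> diameter (U i) powr s"
    proof (cases "diameter (U i) = 0")
      case False
      then have "diameter (U i) powr 1 \<le> diameter (U i) powr s"
        using d U(3)[of i] assms by (intro powr_mono') auto
      then show ?thesis using d by simp
    qed simp
    moreover have "emeasure lebesgue (V i) = ennreal (2 * diameter (U i))"
      using d by (simp add: V_def cball_eq_atLeastAtMost)
    moreover have "2 * ennreal (diameter (U i) powr s) = ennreal (2 * diameter (U i) powr s)"
      by (simp add: ennreal_mult')
    ultimately show ?thesis by (simp add: ennreal_leI)
  qed
  then have "(\<Sum>i. emeasure lebesgue (V i)) \<le> (\<Sum>i. 2 * ennreal (diameter (U i) powr s))"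
    by (intro suminf_le) auto
  also have "\<dots> = 2 * (\<Sum>i. ennreal (diameter (U i) powr s))" by (rule ennreal_suminf_cmult)
  also have "\<dots> \<le> 2 * ennreal (e / 2)" using U(4) by (intro mult_left_mono) auto
  also have "\<dots> = ennreal e" using e by (simp add: ennreal_mult'[symmetric] flip: ennreal_numeral)
  finally have "(\<Sum>i. emeasure lebesgue (V i)) \<le> ennreal e" .
  moreover have "emeasure lebesgue (\<Union>i. V i) \<le> (\<Sum>i. emeasure lebesgue (V i))"
    by (intro emeasure_subadditive_countably) (auto simp: V_def)
  ultimately have le: "emeasure lebesgue (\<Union>i. V i) \<le> ennreal e" by (rule order_trans[rotated])
  have "(\<Union>i. V i) \<in> lmeasurable"
    using le by (intro fmeasurableI) (auto simp: V_def intro: le_less_trans)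
  moreover have "measure lebesgue (\<Union>i. V i) \<le> e"
    using le e by (simp add: measure_def enn2real_leI)
  ultimately show "\<exists>T. A \<subseteq> T \<and> T \<in> lmeasurable \<and> measure lebesgue T \<le> e"
    using U(1) UV by (intro exI[of _ "\<Union>i. V i"]) blast
qed

text \<open>The whole line is covered at once by intervals of lengths \<open>h / (k + 1)\<close>:
  the harmonic series diverges, whereas the \<open>s\<close>-th powers have a finite sum that scales
  like \<open>h powr s\<close>.\<close>

lemma hausdorff_measure_real_eq_0:
  fixes A :: "real set"
  assumes s: "s > 1"
  shows "hausdorff_measure s A = 0"
proof -
  have sums: "summable (\<lambda>n. (1 / real (Suc n)) powr s)"
  proof -
    have "summable (\<lambda>n. real (Suc n) powr (- s))"
      using s by (subst summable_Suc_iff) (simp add: summable_real_powr_iff)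
    then show ?thesis by (simp add: powr_minus powr_divide inverse_eq_divide)
  qed
  define Z where "Z = (\<Sum>n. (1 / real (Suc n)) powr s)"
  have "hausdorff_premeasure s \<delta> A = 0" if \<delta>: "\<delta> > 0" for \<delta>
  proof (rule ennreal_eq_0_if_le_tendsto[OF _ _ \<delta>])
    have "((\<lambda>h. (2 * h) powr s * Z) \<longlongrightarrow> (2 * 0) powr s * Z) (at_right 0)"
      using s by (intro tendsto_intros) (auto simp: eventually_at_right_field intro!: exI[of _ 1])
    then show "((\<lambda>h. (2 * h) powr s * Z) \<longlongrightarrow> 0) (at_right 0)" using s by simp
  next
    fix h :: real assume h: "0 < h" "h \<le> \<delta>"
    define I where "I k = {h * harm k..h * harm (Suc k)}" for k
    \<comment> \<open>Even indices cover the nonnegative reals, odd ones the reflected half.\<close>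
    define U where "U n = (if even n then I (n div 2) else uminus ` I (n div 2))" for n
    have diam: "diameter (U n) = h / real (Suc (n div 2))" for n
    proof -
      have "uminus ` I k = {- (h * harm (Suc k))..- (h * harm k)}" for k by (simp add: I_def)
      moreover have "\<not> h * harm (Suc k) < h * harm k" for k
        unfolding not_less using h by (intro mult_left_mono) (auto simp: harm_Suc)
      moreover have "h * harm (Suc k) - h * harm k = h / real (Suc k)" for k
        by (simp add: harm_Suc algebra_simps divide_inverse)
      ultimately show ?thesis by (simp add: U_def I_def)
    qed
    have cover: "\<exists>k. x \<in> I k" if "x \<ge> 0" for x
    proof -
      have "eventually (\<lambda>k. harm k > x / h) sequentially"
        using harm_at_top unfolding filterlim_at_top_dense by blast
      then have "\<exists>k. harm k > x / h" by (auto simp: eventually_sequentially)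
      define K where "K = (LEAST k. harm k > x / h)"
      have K: "harm K > x / h" unfolding K_def using \<open>\<exists>k. _\<close> by (rule LeastI_ex)
      have "0 \<le> x / h" using that h by simp
      then obtain k where k: "K = Suc k" using K by (cases K) (auto simp: harm_def)
      have "\<not> harm k > x / h" using not_less_Least[of k "\<lambda>k. harm k > x / h"] k by (simp add: K_def)
      then show ?thesis using K h unfolding k by (intro exI[of _ k]) (simp add: I_def field_simps)
    qed
    have "x \<in> (\<Union>n. U n)" for x
    proof (cases "x \<ge> 0")
      case True
      then obtain k where "x \<in> I k" using cover by blast
      then have "x \<in> U (2 * k)" by (simp add: U_def)
      then show ?thesis by blast
    next
      case False
      then obtain k where "- x \<in> I k" using cover[of "- x"] by auto
      then have "x \<in> uminus ` I k" by (metis image_eqI minus_minus)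
      then have "x \<in> U (2 * k + 1)" by (simp add: U_def)
      then show ?thesis by blast
    qed
    moreover have "bounded (U n)" for n
      by (simp add: U_def I_def)
    moreover have "diameter (U n) \<le> \<delta>" for n
    proof -
      have "h / real (Suc (n div 2)) \<le> h / 1" using h by (intro divide_left_mono) auto
      then show ?thesis using h by (simp add: diam)
    qed
    ultimately have "hausdorff_premeasure s \<delta> A \<le> (\<Sum>n. ennreal (diameter (U n) powr s))"
      unfolding hausdorff_premeasure_def by (intro Inf_lower) blast
    also have "\<dots> \<le> (\<Sum>n. ennreal ((2 * h) powr s * (1 / real (Suc n)) powr s))"
    proof (rule suminf_le)
      fix n
      \<comment> \<open>Interleaving the halves replaces \<open>n\<close> by \<open>n div 2\<close>,
        which costs the factor \<open>2\<close>.\<close>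
      have "diameter (U n) \<le> 2 * h * (1 / real (Suc n))"
      proof -
        have "Suc n \<le> 2 * Suc (n div 2)" by presburger
        then have "real (Suc n) \<le> real (2 * Suc (n div 2))" by (rule of_nat_mono)
        then have "real (Suc n) \<le> 2 * real (Suc (n div 2))" by (simp only: of_nat_mult of_nat_numeral)
        then have "h * real (Suc n) \<le> h * (2 * real (Suc (n div 2)))" using h by (intro mult_left_mono) auto
        then show ?thesis unfolding diam by (simp add: divide_simps mult_ac del: of_nat_Suc)
      qed
      moreover have "0 \<le> diameter (U n)" using h by (simp add: diam)
      ultimately have "diameter (U n) powr s \<le> (2 * h * (1 / real (Suc n))) powr s"
        using s by (intro powr_mono2) auto
      then show "ennreal (diameter (U n) powr s) \<le> ennreal ((2 * h) powr s * (1 / real (Suc n)) powr s)"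
        using h by (subst (asm) powr_mult) (auto intro: ennreal_leI)
    qed auto
    also have "\<dots> = ennreal (\<Sum>n. (2 * h) powr s * (1 / real (Suc n)) powr s)"
      using sums by (intro suminf_ennreal2 summable_mult) auto
    also have "\<dots> = ennreal ((2 * h) powr s * Z)"
      unfolding Z_def using sums by (simp only: suminf_mult)
    finally show "hausdorff_premeasure s \<delta> A \<le> ennreal ((2 * h) powr s * Z)" .
  qed
  then show ?thesis unfolding hausdorff_measure_def by simp
qed

lemma Inf_ereal_eq_1I:
  assumes "\<And>s::real. s > 1 \<Longrightarrow> P s" "\<And>s. P s \<Longrightarrow> s \<ge> 1"
  shows "Inf {ereal s | s. P s} = 1"
proof (rule antisym)
  show "Inf {ereal s | s. P s} \<le> 1"
  proof (rule dense_ge)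
    fix z :: ereal assume "1 < z"
    then show "Inf {ereal s | s. P s} \<le> z"
      using assms(1) by (cases z) (auto intro!: Inf_lower)
  qed
  show "1 \<le> Inf {ereal s | s. P s}"
    using assms(2) by (auto intro!: Inf_greatest)
qed

lemma hausdorff_dim_eq_1:
  fixes A :: "real set"
  assumes "\<not> negligible A"
  shows "hausdorff_dim A = 1"
  unfolding hausdorff_dim_def
proof (rule Inf_ereal_eq_1I)
  fix s assume "0 < s \<and> hausdorff_measure s A = 0"
  then show "1 \<le> s" using negligible_if_hausdorff_measure_0 assms not_le by blast
qed (simp add: hausdorff_measure_real_eq_0)

section \<open>Packing dimension\<close>

text \<open>For \<open>r \<le> h\<close> the term \<open>(2 * r) powr s\<close> is at most
  \<open>(2 * h) powr (s - 1)\<close> times the length of the ball. Disjoint balls in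
  \<open>{- (R + h)..R + h}\<close> have total length at most \<open>2 * (R + h)\<close>, and the
  first factor vanishes with \<open>h\<close>.\<close>

lemma packing_premeasure_bounded_eq_0:
  fixes A :: "real set"
  assumes s: "s > 1" and A: "A \<subseteq> {-R..R}" and R: "R \<ge> 0"
  shows "packing_premeasure s A = 0"
proof (rule ennreal_eq_0_if_le_tendsto[where \<delta> = 1])
  have "((\<lambda>h. (2 * h) powr (s - 1) * (2 * (R + h))) \<longlongrightarrow> (2 * 0) powr (s - 1) * (2 * (R + 0))) (at_right 0)"
    using s by (intro tendsto_intros) (auto simp: eventually_at_right_field intro!: exI[of _ 1])
  then show "((\<lambda>h. (2 * h) powr (s - 1) * (2 * (R + h))) \<longlongrightarrow> 0) (at_right 0)" using s by simp
next
  fix h :: real assume h: "0 < h" "h \<le> 1"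
  have "packing_premeasure s A \<le> packing_premeasure_delta s h A"
    unfolding packing_premeasure_def using h by (intro INF_lower) simp
  also have "\<dots> \<le> ennreal ((2 * h) powr (s - 1) * (2 * (R + h)))"
    unfolding packing_premeasure_delta_def
  proof (rule SUP_least)
    fix K assume K: "K \<in> packings h A"
    show "(\<Sum>\<^sub>\<infinity>(x, r)\<in>K. ennreal ((2 * r) powr s)) \<le> ennreal ((2 * h) powr (s - 1) * (2 * (R + h)))"
    proof (rule infsum_le_finite_sums)
      show "(\<lambda>(x, r). ennreal ((2 * r) powr s)) summable_on K"
        by (rule nonneg_summable_on_complete) auto
      fix F assume F: "finite F" "F \<subseteq> K"
      have mem: "x \<in> A" "0 < r" "r \<le> h" if "(x, r) \<in> F" for x r
        using that F K by (auto simp: packings_def)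
      have "(\<Sum>(x, r)\<in>F. ennreal ((2 * r) powr s)) = ennreal (\<Sum>(x, r)\<in>F. (2 * r) powr s)"
        by (simp add: case_prod_unfold)
      also have "\<dots> \<le> ennreal ((2 * h) powr (s - 1) * (2 * (R + h)))"
      proof (rule ennreal_leI)
        have "(\<Sum>(x, r)\<in>F. (2 * r) powr s) \<le> (\<Sum>(x, r)\<in>F. (2 * h) powr (s - 1) * (2 * r))"
        proof (intro sum_mono, clarify)
          fix x r assume xr: "(x, r) \<in> F"
          have "(2 * r) powr s = (2 * r) powr (s - 1) * (2 * r)"
            using mem[OF xr] powr_mult_base[of "2 * r" "s - 1"] by (simp add: mult.commute)
          also have "\<dots> \<le> (2 * h) powr (s - 1) * (2 * r)"
            using mem[OF xr] s by (intro mult_right_mono powr_mono2) auto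
          finally show "(2 * r) powr s \<le> (2 * h) powr (s - 1) * (2 * r)" .
        qed
        also have "\<dots> = (2 * h) powr (s - 1) * (\<Sum>(x, r)\<in>F. 2 * r)"
          by (simp add: sum_distrib_left case_prod_unfold)
        also have "\<dots> \<le> (2 * h) powr (s - 1) * (2 * (R + h))"
        proof (rule mult_left_mono)
          have "(\<Sum>(x, r)\<in>F. 2 * r) = (\<Sum>(x, r)\<in>F. measure lebesgue (cball x r))"
            using mem by (intro sum.cong) (auto simp: cball_eq_atLeastAtMost less_imp_le)
          also have "\<dots> = measure lebesgue (\<Union>(x, r)\<in>F. cball x r)"
          proof -
            have "disjoint_family_on (\<lambda>(x, r). cball x r) F"
              using K F by (auto simp: packings_def intro: disjoint_family_on_mono)
            moreover have "emeasure lborel (cball x r) \<noteq> top" for x r :: real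
              using emeasure_lborel_cball_finite[of x r] by simp
            ultimately show ?thesis using F(1)
              by (subst measure_finite_Union) (auto simp: case_prod_unfold)
          qed
          also have "\<dots> \<le> measure lebesgue {-(R + h)..R + h}"
          proof (rule measure_mono_fmeasurable)
            show "(\<Union>(x, r)\<in>F. cball x r) \<subseteq> {- (R + h)..R + h}"
              using mem A by (force simp: cball_eq_atLeastAtMost)
            show "(\<Union>(x, r)\<in>F. cball x r) \<in> sets lebesgue" using F(1) by auto
          qed auto
          also have "\<dots> = 2 * (R + h)" using R h by simp
          finally show "(\<Sum>(x, r)\<in>F. 2 * r) \<le> 2 * (R + h)" .
        qed simp
        finally show "(\<Sum>(x, r)\<in>F. (2 * r) powr s) \<le> (2 * h) powr (s - 1) * (2 * (R + h))" .
      qed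
      finally show "(\<Sum>(x, r)\<in>F. ennreal ((2 * r) powr s)) \<le> ennreal ((2 * h) powr (s - 1) * (2 * (R + h)))" .
    qed
  qed
  finally show "packing_premeasure s A \<le> ennreal ((2 * h) powr (s - 1) * (2 * (R + h)))" .
qed simp

lemma packing_measure_real_eq_0:
  fixes A :: "real set"
  assumes "s > 1"
  shows "packing_measure s A = 0"
proof -
  define B where "B n = A \<inter> {- real n..real n}" for n
  have "A \<subseteq> (\<Union>n. B n)"
  proof
    fix x assume "x \<in> A"
    then have "x \<in> B (nat \<lceil>\<bar>x\<bar>\<rceil>)" unfolding B_def by (simp add: abs_le_iff) linarith
    then show "x \<in> (\<Union>n. B n)" by blast
  qed
  then have "packing_measure s A \<le> (\<Sum>n. packing_premeasure s (B n))"
    unfolding packing_measure_def by (intro Inf_lower) blast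
  also have "(\<lambda>n. packing_premeasure s (B n)) = (\<lambda>n. 0)"
    by (intro ext packing_premeasure_bounded_eq_0[OF assms, of _ "real _"]) (auto simp: B_def)
  finally show ?thesis by simp
qed

text \<open>The premeasure bounds the size of every packing by balls of radius \<open>r\<close>. The
  centres of a largest one form a \<open>2 * r\<close>-net, since a point farther from all of them
  could be added.\<close>

lemma finite_net_of_packing_bound:
  fixes A :: "'a::euclidean_space set"
  assumes le: "packing_premeasure_delta s \<delta> A \<le> ennreal M" and M: "M \<ge> 0" and r: "0 < r" "r \<le> \<delta>"
  obtains F where "finite F" "real (card F) * (2 * r) powr s \<le> M" "\<And>a. a \<in> A \<Longrightarrow> \<exists>x\<in>F. dist a x \<le> 2 * r"
proof -
  define sep where "sep F \<longleftrightarrow> finite F \<and> F \<subseteq> A \<and> disjoint_family_on (\<lambda>x. cball x r) F" for F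
  have bound: "real (card F) * (2 * r) powr s \<le> M" if F: "sep F" for F
  proof -
    have "(\<lambda>x. (x, r)) ` F \<in> packings \<delta> A"
      using F r by (auto simp: packings_def sep_def disjoint_family_on_def countable_finite)
    then have "(\<Sum>\<^sub>\<infinity>(x, r)\<in>(\<lambda>x. (x, r)) ` F. ennreal ((2 * r) powr s)) \<le> packing_premeasure_delta s \<delta> A"
      unfolding packing_premeasure_delta_def by (rule SUP_upper)
    moreover have "(\<Sum>\<^sub>\<infinity>(x, r)\<in>(\<lambda>x. (x, r)) ` F. ennreal ((2 * r) powr s)) = ennreal (real (card F) * (2 * r) powr s)"
      using F by (simp add: sep_def sum.reindex inj_on_def ennreal_mult' ennreal_of_nat_eq_real_of_nat)
    ultimately have "ennreal (real (card F) * (2 * r) powr s) \<le> ennreal M" using le by simp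
    then show ?thesis using M by simp
  qed
  have "\<exists>F. sep F \<and> (\<forall>G. sep G \<longrightarrow> card G \<le> card F)"
  proof (rule ex_has_greatest_nat)
    show "sep {}" by (simp add: sep_def disjoint_family_on_def)
    show "\<forall>G. sep G \<longrightarrow> card G < nat \<lceil>M / (2 * r) powr s\<rceil> + 1"
    proof (intro allI impI)
      fix G assume "sep G"
      from bound[OF this] have "real (card G) \<le> M / (2 * r) powr s"
        using r by (simp add: field_simps)
      then show "card G < nat \<lceil>M / (2 * r) powr s\<rceil> + 1" by linarith
    qed
  qed
  then obtain F where F: "sep F" "\<And>G. sep G \<Longrightarrow> card G \<le> card F" by blast
  have "\<exists>x\<in>F. dist a x \<le> 2 * r" if a: "a \<in> A" for a
  proof (rule ccontr)
    assume n: "\<not> (\<exists>x\<in>F. dist a x \<le> 2 * r)"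
    then have "a \<notin> F" using r by force
    have disj: "cball a r \<inter> cball x r = {}" if "x \<in> F" for x
    proof (rule ccontr)
      assume "cball a r \<inter> cball x r \<noteq> {}"
      then obtain y where "dist a y \<le> r" "dist x y \<le> r" by auto
      then have "dist a x \<le> 2 * r" using dist_triangle2[of a x y] by linarith
      then show False using n that by blast
    qed
    have "sep (insert a F)"
      using F(1) a disj \<open>a \<notin> F\<close> unfolding sep_def by (auto simp: disjoint_family_on_insert)
    from F(2)[OF this] show False using F(1) \<open>a \<notin> F\<close> by (simp add: sep_def)
  qed
  then show thesis using that F(1) bound by (auto simp: sep_def)
qed

text \<open>Some cover has total premeasure below \<open>1\<close>, so each piece has a scale
  \<open>\<delta>\<close> with a uniform packing bound. Thus \<open>A\<close> splits into countably
  many pieces of upper box dimension at most \<open>s\<close>, when \<open>s\<close> is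
  positive.\<close>

lemma packing_measure_0_cover:
  fixes A :: "'a::euclidean_space set"
  assumes "packing_measure s A = 0"
  obtains B where "A \<subseteq> (\<Union>i::nat. B i)" "\<And>i. \<exists>\<delta>>0. packing_premeasure_delta s \<delta> (B i) \<le> ennreal 1"
proof -
  have "packing_measure s A < 1" using assms by simp
  then obtain B :: "nat \<Rightarrow> 'a set" where B: "A \<subseteq> (\<Union>i. B i)" "(\<Sum>i. packing_premeasure s (B i)) < 1"
    unfolding packing_measure_def Inf_less_iff by auto
  have "\<exists>\<delta>>0. packing_premeasure_delta s \<delta> (B i) \<le> ennreal 1" for i
  proof -
    have "packing_premeasure s (B i) < 1" using B(2) by (rule ennreal_suminf_lessD)
    then show ?thesis unfolding packing_premeasure_def INF_less_iff by (auto intro: less_imp_le)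
  qed
  then show thesis using that B(1) by blast
qed

text \<open>This replaces the inequality between the Hausdorff dimension of a sumset and the sum of the
  Hausdorff and packing dimensions: for large \<open>L\<close> the first summand has Hausdorff dimension close to
  \<open>0\<close>.\<close>
lemma negligible_approximable_sumset:
  fixes B :: "real set"
  assumes s: "0 < s" "s < 1" and B: "packing_measure s B = 0" and L: "L * (1 - s) > 2"
  shows "negligible ({\<xi>. infinite (approximants (\<lambda>q. real q powr (- L)) \<xi>)} + B)"
proof -
  \<comment> \<open>Unit intervals keep the number of numerators for a given \<open>q\<close> at
    \<open>q + 3\<close>.\<close>
  define E where "E m = {\<xi>. of_int m \<le> \<xi> \<and> \<xi> \<le> of_int m + 1 \<and> infinite (approximants (\<lambda>q. real q powr (- L)) \<xi>)}"
    for m :: int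
  have "L > 0" using L s by (metis diff_gt_0_iff_gt less_trans zero_less_mult_pos2 zero_less_numeral)
  then have "L * (1 - s) < L * 1" using s by (intro mult_strict_left_mono) auto
  then have L2: "L > 2" using L by simp
  obtain D where D: "B \<subseteq> (\<Union>i::nat. D i)" "\<And>i. \<exists>\<delta>>0. packing_premeasure_delta s \<delta> (D i) \<le> ennreal 1"
    using packing_measure_0_cover[OF B] by blast
  have "negligible (E m + D i)" for m i
  proof -
    obtain \<delta> where \<delta>: "\<delta> > 0" "packing_premeasure_delta s \<delta> (D i) \<le> ennreal 1" using D(2) by blast
    define r where "r q = real q powr (- L)" for q :: nat
    have "((\<lambda>t::real. t powr (- L)) \<longlongrightarrow> 0) at_top"
      using \<open>L > 0\<close> by (intro tendsto_neg_powr filterlim_ident) simp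
    then have "eventually (\<lambda>t::real. t powr (- L) < \<delta>) at_top" using \<delta> by (intro order_tendstoD(2))
    then obtain R where R: "\<And>t::real. t \<ge> R \<Longrightarrow> t powr (- L) < \<delta>" by (auto simp: eventually_at_top_linorder)
    define N where "N = nat \<lceil>R\<rceil> + 1"
    have N: "0 < r q \<and> r q \<le> \<delta>" if "q \<ge> N" for q
    proof -
      have "real q \<ge> R" "q \<noteq> 0" using that unfolding N_def by linarith+
      then show ?thesis using R[of "real q"] by (simp add: r_def)
    qed
    have "\<exists>G. q \<ge> N \<longrightarrow> finite G \<and> real (card G) * (2 * r q) powr s \<le> 1 \<and> (\<forall>a\<in>D i. \<exists>x\<in>G. dist a x \<le> 2 * r q)" for q
      using finite_net_of_packing_bound[OF \<delta>(2), of "r q"] N[of q] by (metis zero_le_one)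
    then obtain G where G: "\<And>q. q \<ge> N \<Longrightarrow> finite (G q)"
        "\<And>q. q \<ge> N \<Longrightarrow> real (card (G q)) * (2 * r q) powr s \<le> 1"
        "\<And>q a. q \<ge> N \<Longrightarrow> a \<in> D i \<Longrightarrow> \<exists>x\<in>G q. dist a x \<le> 2 * r q"
      by metis
    define P where "P q = {m * int q - 1..(m + 1) * int q + 1}" for q :: nat
    define F where "F q = (\<lambda>(p, x). of_int p / real q + x) ` (P q \<times> G q)" for q
    \<comment> \<open>The radius \<open>3 * r q\<close> adds the approximation error
      \<open>r q\<close> and the net error \<open>2 * r q\<close>. With at most \<open>4 * q\<close>
      numerators this gives the constant \<open>24 = 4 * 2 * 3\<close>, and the series converges
      because \<open>L * (1 - s) > 2\<close>.\<close>
    show ?thesis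
    proof (rule negligible_infinitely_often[where N = N and F = F and r = "\<lambda>q. 3 * r q"
          and f = "\<lambda>q. 24 * real q powr (1 - L * (1 - s))"])
      show "finite (F q)" if "q \<ge> N" for q using G(1)[OF that] by (simp add: F_def P_def)
      show "0 \<le> 3 * r q" for q by (simp add: r_def)
      show "summable (\<lambda>q. 24 * real q powr (1 - L * (1 - s)))"
        using L by (intro summable_mult) (simp add: summable_real_powr_iff)
    next
      fix q assume q: "N \<le> q"
      have q1: "q \<ge> 1" using q by (simp add: N_def)
      have "card (P q) = q + 3" by (simp add: P_def algebra_simps)
      then have "card (F q) \<le> (q + 3) * card (G q)"
        unfolding F_def using G(1)[OF q] by (metis P_def card_cartesian_product card_image_le finite_SigmaI finite_atLeastAtMost_int)
      also have "\<dots> \<le> (4 * q) * card (G q)" using q1 by (intro mult_right_mono) auto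
      finally have "real (card (F q)) \<le> 4 * real q * real (card (G q))"
        by (metis of_nat_le_iff of_nat_mult of_nat_numeral)
      then have "real (card (F q)) * (2 * (3 * r q)) \<le> (4 * real q * real (card (G q))) * (2 * (3 * r q))"
        using N[OF q] by (intro mult_right_mono) auto
      also have "\<dots> = 24 * real q * (real (card (G q)) * r q)" by simp
      also have "real (card (G q)) * r q \<le> r q powr (1 - s)"
      proof -
        have "r q powr s \<le> (2 * r q) powr s" using N[OF q] s by (intro powr_mono2) auto
        then have "real (card (G q)) * r q powr s \<le> 1"
          using G(2)[OF q] mult_left_mono[of "r q powr s" "(2 * r q) powr s" "real (card (G q))"] by linarith
        then have "(real (card (G q)) * r q powr s) * r q powr (1 - s) \<le> 1 * r q powr (1 - s)"
          by (intro mult_right_mono) auto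
        then show ?thesis using N[OF q] by (simp add: mult.assoc flip: powr_add)
      qed
      also have "24 * real q * r q powr (1 - s) = 24 * real q powr (1 - L * (1 - s))"
        using q1 by (simp add: r_def powr_powr powr_mult_base)
      finally show "real (card (F q)) * (2 * (3 * r q)) \<le> 24 * real q powr (1 - L * (1 - s))"
        using q1 by simp
    next
      fix z assume "z \<in> E m + D i"
      then obtain x y where z: "z = x + y" and x: "x \<in> E m" and y: "y \<in> D i" by (rule set_plus_elim)
      have "infinite {q. q \<ge> 1 \<and> (\<exists>p::int. \<bar>x - of_int p / real q\<bar> \<le> real q powr (- L))}"
        using x by (intro infinite_approximantsD) (simp add: E_def)
      then have "infinite ({q. q \<ge> 1 \<and> (\<exists>p::int. \<bar>x - of_int p / real q\<bar> \<le> real q powr (- L))} - {..<N})"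
        by simp
      moreover have "\<exists>a\<in>F q. \<bar>z - a\<bar> \<le> 3 * r q"
        if q: "q \<ge> 1" "q \<ge> N" and p: "\<bar>x - of_int p / real q\<bar> \<le> real q powr (- L)" for p :: int and q
      proof -
        have "real q powr (- L) \<le> real q powr (- 1)" using q L2 by (intro powr_mono) auto
        then have "real q powr (- L) \<le> 1 / real q" using q by (simp add: powr_minus field_simps)
        then have "p \<in> P q"
          using x q p unfolding P_def by (intro numerator_range[of q m x]) (auto simp: E_def)
        moreover obtain g where g: "g \<in> G q" "dist y g \<le> 2 * r q" using G(3)[OF q(2) y] by blast
        ultimately have "of_int p / real q + g \<in> F q" by (force simp: F_def)
        moreover have "\<bar>z - (of_int p / real q + g)\<bar> \<le> 3 * r q"
          using p g(2) unfolding z r_def dist_real_def by linarith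
        ultimately show ?thesis by blast
      qed
      ultimately show "infinite {q. \<exists>a\<in>F q. \<bar>z - a\<bar> \<le> 3 * r q}"
        by (elim infinite_super[rotated]) auto
    qed
  qed
  then have "negligible (\<Union>(m, i). E m + D i)"
    by (intro negligible_countable_Union) auto
  moreover have "{\<xi>. infinite (approximants (\<lambda>q. real q powr (- L)) \<xi>)} + B \<subseteq> (\<Union>(m, i). E m + D i)"
  proof
    fix z assume "z \<in> {\<xi>. infinite (approximants (\<lambda>q. real q powr (- L)) \<xi>)} + B"
    then obtain x y where z: "z = x + y" and x: "infinite (approximants (\<lambda>q. real q powr (- L)) x)" and y: "y \<in> B"
      by (auto elim: set_plus_elim)
    obtain i where "y \<in> D i" using D(1) y by blast
    moreover have "x \<in> E \<lfloor>x\<rfloor>" using x unfolding E_def by simp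
    ultimately have "z \<in> E \<lfloor>x\<rfloor> + D i" unfolding z by (rule set_plus_intro[rotated])
    then show "z \<in> (\<Union>(m, i). E m + D i)" by blast
  qed
  ultimately show ?thesis using negligible_subset by blast
qed

lemma packing_dim_exact_approx_set:
  fixes C L :: real and \<Phi> :: "nat \<Rightarrow> real"
  assumes C: "0 < C" "C < 1" and L: "L > (5 + sqrt 17) / 2"
    and Phi: "\<forall>q\<ge>1. \<Phi> q > 0" "antimono_on {1..} \<Phi>" "\<exists>q\<^sub>0. \<forall>q\<ge>q\<^sub>0. \<Phi> q \<le> real q powr (- L)"
  shows "packing_dim (exact_approx_set \<Phi> C) = 1"
  unfolding packing_dim_def
proof (rule Inf_ereal_eq_1I)
  fix s assume s: "0 < s \<and> packing_measure s (exact_approx_set \<Phi> C) = 0"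
  show "1 \<le> s"
  proof (rule ccontr)
    assume "\<not> 1 \<le> s"
    \<comment> \<open>\<open>K \<ge> L\<close> makes \<open>W2_subset_sumset\<close> applicable to
      \<open>\<Psi>\<close>, and \<open>3 / (1 - s)\<close> gives
      \<open>K * (1 - s) \<ge> 3\<close>, so that the sumset is negligible.\<close>
    define K where "K = max L (3 / (1 - s))"
    define \<Psi> where "\<Psi> q = real q powr (- K)" for q :: nat
    have "3 / (1 - s) \<le> K" by (simp add: K_def)
    then have "K * (1 - s) > 2" using \<open>\<not> 1 \<le> s\<close> by (simp add: field_simps)
    then have neg: "negligible ({\<xi>. infinite (approximants \<Psi> \<xi>)} + exact_approx_set \<Phi> C)"
      unfolding \<Psi>_def using s \<open>\<not> 1 \<le> s\<close> by (intro negligible_approximable_sumset[of s]) auto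
    have "0 < (5 + sqrt 17) / 2" by (simp add: add_pos_nonneg)
    then have "L > 0" using L by (rule less_trans)
    then have K: "K > 0" by (simp add: K_def)
    have "W2 \<subseteq> exact_approx_set \<Psi> C + exact_approx_set \<Phi> C"
    proof (rule W2_subset_sumset[OF C L])
      show "\<forall>q\<ge>1. \<Psi> q > 0" by (simp add: \<Psi>_def)
      show "antimono_on {1..} \<Psi>"
        using K by (auto simp: \<Psi>_def monotone_on_def intro!: powr_mono2')
      show "\<exists>q\<^sub>0. \<forall>q\<ge>q\<^sub>0. \<Psi> q \<le> real q powr (- L)"
        by (intro exI[of _ 1]) (auto simp: \<Psi>_def K_def intro!: powr_mono)
    qed (use Phi in auto)
    also have "\<dots> \<subseteq> {\<xi>. infinite (approximants \<Psi> \<xi>)} + exact_approx_set \<Phi> C"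
      by (intro set_plus_mono2) (auto simp: exact_approx_set_def)
    finally show False using neg not_negligible_W2 negligible_subset by blast
  qed
qed (simp add: packing_measure_real_eq_0)

theorem theorem3p15:
  fixes C L\<^sub>0 L\<^sub>1 :: real and \<Phi>\<^sub>0 \<Phi>\<^sub>1 :: "nat \<Rightarrow> real"
  assumes "0 < C" and "C < 1"
    and "min L\<^sub>0 L\<^sub>1 > (5 + sqrt 17) / 2"
    and "\<forall>q\<ge>1. \<Phi>\<^sub>0 q > 0" and "antimono_on {1..} \<Phi>\<^sub>0"
    and "\<exists>q\<^sub>0. \<forall>q\<ge>q\<^sub>0. \<Phi>\<^sub>0 q \<le> of_nat q powr (- L\<^sub>0)"
    and "\<forall>q\<ge>1. \<Phi>\<^sub>1 q > 0" and "antimono_on {1..} \<Phi>\<^sub>1"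
    and "\<exists>q\<^sub>0. \<forall>q\<ge>q\<^sub>0. \<Phi>\<^sub>1 q \<le> of_nat q powr (- L\<^sub>1)"
  shows "W2 \<subseteq> exact_approx_set \<Phi>\<^sub>0 C + exact_approx_set \<Phi>\<^sub>1 C
       \<and> hausdorff_dim (exact_approx_set \<Phi>\<^sub>0 C + exact_approx_set \<Phi>\<^sub>1 C) = 1
       \<and> packing_dim (exact_approx_set \<Phi>\<^sub>0 C) = 1
       \<and> packing_dim (exact_approx_set \<Phi>\<^sub>1 C) = 1"
proof -
  \<comment> \<open>One common exponent lets the construction treat both functions alike; for
    \<open>q \<ge> 1\<close> lowering the exponent only weakens the bounds.\<close>
  define L where "L = min L\<^sub>0 L\<^sub>1"
  have weaken: "\<exists>q\<^sub>0. \<forall>q\<ge>q\<^sub>0. \<Phi> q \<le> real q powr (- L)"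
    if le: "\<exists>q\<^sub>0. \<forall>q\<ge>q\<^sub>0. \<Phi> q \<le> real q powr (- M)" and "L \<le> M" for \<Phi> :: "nat \<Rightarrow> real" and M
  proof -
    obtain q\<^sub>0 where q0: "\<And>q. q \<ge> q\<^sub>0 \<Longrightarrow> \<Phi> q \<le> real q powr (- M)" using le by blast
    have "\<Phi> q \<le> real q powr (- L)" if "q \<ge> max q\<^sub>0 1" for q
    proof -
      have "real q powr (- M) \<le> real q powr (- L)" using that \<open>L \<le> M\<close> by (intro powr_mono) auto
      then show ?thesis using q0[of q] that by simp
    qed
    then show ?thesis by blast
  qed
  have L: "L > (5 + sqrt 17) / 2" using assms(3) by (simp only: L_def)
  have le0: "\<exists>q\<^sub>0. \<forall>q\<ge>q\<^sub>0. \<Phi>\<^sub>0 q \<le> real q powr (- L)"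
    using weaken[OF assms(6)] by (simp add: L_def)
  have le1: "\<exists>q\<^sub>0. \<forall>q\<ge>q\<^sub>0. \<Phi>\<^sub>1 q \<le> real q powr (- L)"
    using weaken[OF assms(9)] by (simp add: L_def)
  have sub: "W2 \<subseteq> exact_approx_set \<Phi>\<^sub>0 C + exact_approx_set \<Phi>\<^sub>1 C"
    by (rule W2_subset_sumset[OF assms(1,2) L assms(4,5) le0 assms(7,8) le1])
  then have "\<not> negligible (exact_approx_set \<Phi>\<^sub>0 C + exact_approx_set \<Phi>\<^sub>1 C)"
    using not_negligible_W2 negligible_subset by blast
  then show ?thesis
    using sub hausdorff_dim_eq_1 packing_dim_exact_approx_set[OF assms(1,2) L assms(4,5) le0]
      packing_dim_exact_approx_set[OF assms(1,2) L assms(7,8) le1] by blast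
qed

end
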